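(* Let $S$ be a semigroup with zero which is categorical at zero, and let $\bar S$ be its 0-reflector. Then for every $n\ge 0$ and every 0-module $A$ over $S$ the homomorphism $\varepsilon_n^{\ast}: H_n^0(S,A)\to H_n(\bar S,A)$ is an isomorphism.
   Context: A semigroup $S$ with zero is categorical at zero if for all $x,y,z\in S$, $xyz=0$ implies $xy=0$ or $yz=0$. 0-reflector: Let $S$ be a semigroup with zero $0$, and let $(S)$ be the set of all finite sequences $(s_1,\dots,s_n)$, $n\ge 1$, with $s_i\in S\setminus\{0\}$ for all $i$ and $s_is_{i+1}=0$ for $1\le i\le n-1$. Define a relation $\nu$ on $(S)$: $(s_1,\dots,s_m)\,\nu\,(t_1,\dots,t_n)$ iff one of the following holds: (1) $m=n$ and there are $1\le i\le m-1$ and $u\in S$ with $s_i=t_iu$, $t_{i+1}=us_{i+1}$, and $s_j=t_j$ for $j\ne i,i+1$; (2) $m=n+1$ and there are $2\le i\le m-1$ and $u,v\in S$ with $s_i=uv$, $t_{i-1}=s_{i-1}u$, $t_i=vs_{i+1}$, $s_j=t_j$ for $1\le j\le i-2$, and $s_j=t_{j-1}$ for $i+2\le j\le m$. Let $\bar S$ be the quotient of $(S)$ by the least equivalence relation containing $\nu$, and write $\langle s_1,\dots,s_n\rangle$ for the class of $(s_1,\dots,s_n)$. Then $\bar S$ is a semigroup under $\langle s_1,\dots,s_m\rangle\langle t_1,\dots,t_n\rangle=\langle s_1,\dots,s_{m-1},s_mt_1,t_2,\dots,t_n\rangle$ if $s_mt_1\ne 0$, and $=\langle s_1,\dots,s_m,t_1,\dots,t_n\rangle$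 if $s_mt_1=0$. It is called the 0-reflector of $S$. 0-modules: A (right) 0-module over $S$ is an abelian group $A$ with a map $A\times(S\setminus\{0\})\to A$, $(a,s)\mapsto as$, such that $(a+b)s=as+bs$, and $(as)t=a(st)$ whenever $st\ne 0$. A 0-module $A$ over $S$ is regarded as an (ordinary, right) $\bar S$-module by $a\langle s_1,\dots,s_n\rangle=(\dots((as_1)s_2)\dots)s_n$. 0-homology: For $n\ge 1$ let $C_n^0(S,A)$ be the abelian group of finite formal sums of terms $a[s_1,\dots,s_n]$ with $a\in A$, $s_i\in S$, $s_1s_2\cdots s_n\ne 0$ (i.e. the direct sum of copies of $A$ indexed by such $n$-tuples), and $C_0^0(S,A)=A$. Define $\partial_1(a[s])=as-a$ and, for $n\ge 2$, $\partial_n(a[s_1,\dots,s_n])=as_1[s_2,\dots,s_n]+\sum_{i=1}^{n-1}(-1)^ia[s_1,\dots,s_is_{i+1},\dots,s_n]+(-1)^na[s_1,\dots,s_{n-1}]$. Then $\partial_{n-1}\partial_n=0$. Put $H_n^0(S,A)=\operatorname{Ker}\partial_n/\operatorname{Im}\partial_{n+1}$ for $n\ge1$ and $H_0^0(S,A)=A/\operatorname{Im}\partial_1$. Ordinary (Eilenberg–MacLane) homology: $H_n(\bar S,A)$ is the homology of the complex with $C_0(\bar S,A)=A$, $C_n(\bar S,A)$ the group of finite formal sums of terms $a[x_1,\dots,x_n]$ with $a\in A$ and arbitrary $x_i\in\bar S$, and boundary maps $\delta_n$ given by the same formulas as $\partial_n$; $H_0(\bar S,A)=A/\operatorname{Im}\delta_1$.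 The homomorphisms $\varepsilon_n:C_n^0(S,A)\to C_n(\bar S,A)$, $\varepsilon_n(a[s_1,\dots,s_n])=a[\langle s_1\rangle,\dots,\langle s_n\rangle]$ for $n\ge 1$, $\varepsilon_0=\mathrm{id}_A$, form a chain map; $\varepsilon_n^{\ast}:H_n^0(S,A)\to H_n(\bar S,A)$ denotes the induced homomorphism. *)

theory Defs
  imports "HOL-Algebra.Coset" "HOL-Library.Poly_Mapping"
begin

text \<open>
  A semigroup with zero is a type of sort \<open>{semigroup_mult, mult_zero}\<close>; no unit is assumed and
  the trivial semigroup, consisting of \<open>0\<close> only, is allowed.
\<close>

section \<open>The 0-reflector\<close>

definition zero_seqs :: "'s::{semigroup_mult,mult_zero} list set" where
  "zero_seqs = {xs. xs \<noteq> [] \<and> 0 \<notin> set xs \<and> successively (\<lambda>x y. x * y = 0) xs}"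

inductive nu :: "'s::{semigroup_mult,mult_zero} list \<Rightarrow> 's list \<Rightarrow> bool" where
  shift: "\<lbrakk>xs @ [t * u, s] @ ys \<in> zero_seqs; xs @ [t, u * s] @ ys \<in> zero_seqs\<rbrakk>
    \<Longrightarrow> nu (xs @ [t * u, s] @ ys) (xs @ [t, u * s] @ ys)"
| split: "\<lbrakk>xs @ [p, u * v, q] @ ys \<in> zero_seqs; xs @ [p * u, v * q] @ ys \<in> zero_seqs\<rbrakk>
    \<Longrightarrow> nu (xs @ [p, u * v, q] @ ys) (xs @ [p * u, v * q] @ ys)"

definition nu_rel :: "('s::{semigroup_mult,mult_zero} list \<times> 's list) set" where
  "nu_rel = {(xs, ys). xs \<in> zero_seqs \<and> ys \<in> zero_seqs \<and> equivclp nu xs ys}"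

definition nu_class :: "'s::{semigroup_mult,mult_zero} list \<Rightarrow> 's list set" where
  "nu_class xs = nu_rel `` {xs}"

text \<open>
  The 0-reflector is kept as a set of classes rather than made a type, since it is empty for the
  trivial semigroup.
\<close>

definition reflector :: "'s::{semigroup_mult,mult_zero} list set set" where
  "reflector = zero_seqs // nu_rel"

definition seq_mult :: "'s::{semigroup_mult,mult_zero} list \<Rightarrow> 's list \<Rightarrow> 's list" where
  "seq_mult xs ys =
    (if last xs * hd ys = 0 then xs @ ys else butlast xs @ [last xs * hd ys] @ tl ys)"

definition reflector_mult ::
    "'s::{semigroup_mult,mult_zero} list set \<Rightarrow> 's list set \<Rightarrow> 's list set" where
  "reflector_mult X Y = (\<Union>xs\<in>X. \<Union>ys\<in>Y. nu_class (seq_mult xs ys))"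

section \<open>0-modules\<close>

text \<open>
  The action is a total function; its values at \<open>0\<close> are unconstrained and never used below.
\<close>

locale zero_module =
  fixes act :: "'a::ab_group_add \<Rightarrow> 's::{semigroup_mult,mult_zero} \<Rightarrow> 'a"
  assumes act_add: "s \<noteq> 0 \<Longrightarrow> act (a + b) s = act a s + act b s"
    and act_act: "s * t \<noteq> 0 \<Longrightarrow> act (act a s) t = act a (s * t)"

definition reflector_act ::
    "('a \<Rightarrow> 's::{semigroup_mult,mult_zero} \<Rightarrow> 'a) \<Rightarrow> 'a \<Rightarrow> 's list set \<Rightarrow> 'a" where
  "reflector_act act a X = the_elem ((\<lambda>xs. foldl act a xs) ` X)"

section \<open>Bar complexes\<close>

text \<open>
  The 0-homology of \<open>S\<close> and the ordinary homology of its 0-reflector use the same boundary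
  formula and differ only in the sets \<open>K n\<close> of admissible \<open>n\<close>-tuples. An \<open>n\<close>-chain is a
  finitely supported function from \<open>K n\<close> to the coefficient group, and \<open>a[x\<^sub>1, ..., x\<^sub>n]\<close> is
  \<open>Poly_Mapping.single [x\<^sub>1, ..., x\<^sub>n] a\<close>. In degree 0 the only admissible tuple is the empty one,
  and \<open>C\<^sub>0 = A\<close> is represented by identifying \<open>a\<close> with \<open>a[]\<close>.
\<close>

definition alt_sign :: "nat \<Rightarrow> 'b::ab_group_add \<Rightarrow> 'b" where
  "alt_sign i c = (if even i then c else - c)"

text \<open>Multiplies the entries at the 1-based positions \<open>i\<close> and \<open>i + 1\<close>.\<close>

definition merge_at :: "('x \<Rightarrow> 'x \<Rightarrow> 'x) \<Rightarrow> nat \<Rightarrow> 'x list \<Rightarrow> 'x list" where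
  "merge_at mul i xs = take (i - 1) xs @ [mul (xs ! (i - 1)) (xs ! i)] @ drop (i + 1) xs"

text \<open>
  For \<open>n = 1\<close> the sum is empty and the formula reads \<open>a[x] \<mapsto> (ax)[] - a[]\<close>. The boundary
  vanishes in degree 0, so that all 0-chains are cycles.
\<close>

definition bar_boundary_gen ::
    "('x \<Rightarrow> 'x \<Rightarrow> 'x) \<Rightarrow> ('a::ab_group_add \<Rightarrow> 'x \<Rightarrow> 'a) \<Rightarrow> 'a \<Rightarrow> 'x list \<Rightarrow> ('x list \<Rightarrow>\<^sub>0 'a)" where
  "bar_boundary_gen mul act a xs =
    (if xs = [] then 0
     else Poly_Mapping.single (tl xs) (act a (hd xs))
        + (\<Sum>i = 1..length xs - 1. alt_sign i (Poly_Mapping.single (merge_at mul i xs) a))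
        + alt_sign (length xs) (Poly_Mapping.single (butlast xs) a))"

definition bar_boundary ::
    "('x \<Rightarrow> 'x \<Rightarrow> 'x) \<Rightarrow> ('a::ab_group_add \<Rightarrow> 'x \<Rightarrow> 'a) \<Rightarrow> ('x list \<Rightarrow>\<^sub>0 'a) \<Rightarrow> ('x list \<Rightarrow>\<^sub>0 'a)" where
  "bar_boundary mul act c =
    (\<Sum>xs\<in>Poly_Mapping.keys c. bar_boundary_gen mul act (Poly_Mapping.lookup c xs) xs)"

definition bar_chains :: "(nat \<Rightarrow> 'x list set) \<Rightarrow> nat \<Rightarrow> ('x list \<Rightarrow>\<^sub>0 'a::ab_group_add) set" where
  "bar_chains K n = {c. Poly_Mapping.keys c \<subseteq> K n}"

definition bar_cycle_group ::
    "(nat \<Rightarrow> 'x list set) \<Rightarrow> ('x \<Rightarrow> 'x \<Rightarrow> 'x) \<Rightarrow> ('a::ab_group_add \<Rightarrow> 'x \<Rightarrow> 'a) \<Rightarrow> nat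
      \<Rightarrow> ('x list \<Rightarrow>\<^sub>0 'a) monoid" where
  "bar_cycle_group K mul act n =
    \<lparr>carrier = {c \<in> bar_chains K n. bar_boundary mul act c = 0}, monoid.mult = (+), one = 0\<rparr>"

definition bar_boundaries ::
    "(nat \<Rightarrow> 'x list set) \<Rightarrow> ('x \<Rightarrow> 'x \<Rightarrow> 'x) \<Rightarrow> ('a::ab_group_add \<Rightarrow> 'x \<Rightarrow> 'a) \<Rightarrow> nat
      \<Rightarrow> ('x list \<Rightarrow>\<^sub>0 'a) set" where
  "bar_boundaries K mul act n = bar_boundary mul act ` bar_chains K (Suc n)"

definition bar_homology ::
    "(nat \<Rightarrow> 'x list set) \<Rightarrow> ('x \<Rightarrow> 'x \<Rightarrow> 'x) \<Rightarrow> ('a::ab_group_add \<Rightarrow> 'x \<Rightarrow> 'a) \<Rightarrow> nat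
      \<Rightarrow> ('x list \<Rightarrow>\<^sub>0 'a) set monoid" where
  "bar_homology K mul act n = bar_cycle_group K mul act n Mod bar_boundaries K mul act n"

section \<open>0-homology, homology of the 0-reflector, and the comparison map\<close>

definition nonzero_tuples :: "nat \<Rightarrow> 's::{semigroup_mult,mult_zero} list set" where
  "nonzero_tuples n = {xs. length xs = n \<and> (n \<noteq> 0 \<longrightarrow> foldl (*) (hd xs) (tl xs) \<noteq> 0)}"

definition reflector_tuples :: "nat \<Rightarrow> 's::{semigroup_mult,mult_zero} list set list set" where
  "reflector_tuples n = {Xs. length Xs = n \<and> set Xs \<subseteq> reflector}"

abbreviation zero_homology ::
    "('a::ab_group_add \<Rightarrow> 's::{semigroup_mult,mult_zero} \<Rightarrow> 'a) \<Rightarrow> nat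
      \<Rightarrow> ('s list \<Rightarrow>\<^sub>0 'a) set monoid" where
  "zero_homology act n \<equiv> bar_homology nonzero_tuples (*) act n"

abbreviation reflector_homology ::
    "('a::ab_group_add \<Rightarrow> 's::{semigroup_mult,mult_zero} \<Rightarrow> 'a) \<Rightarrow> nat
      \<Rightarrow> ('s list set list \<Rightarrow>\<^sub>0 'a) set monoid" where
  "reflector_homology act n \<equiv>
    bar_homology reflector_tuples reflector_mult (reflector_act act) n"

definition eps ::
    "('s::{semigroup_mult,mult_zero} list \<Rightarrow>\<^sub>0 'a::ab_group_add) \<Rightarrow> ('s list set list \<Rightarrow>\<^sub>0 'a)" where
  "eps c = (\<Sum>xs\<in>Poly_Mapping.keys c.
    Poly_Mapping.single (map (\<lambda>s. nu_class [s]) xs) (Poly_Mapping.lookup c xs))"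

text \<open>
  \<open>eps\<close> is a chain map, so all members \<open>c\<close> of a homology class \<open>Z\<close> contribute the same coset, and
  the union is just the class of \<open>eps c\<close> for any representative \<open>c\<close>.
\<close>

definition eps_star ::
    "('a::ab_group_add \<Rightarrow> 's::{semigroup_mult,mult_zero} \<Rightarrow> 'a) \<Rightarrow> nat
      \<Rightarrow> ('s list \<Rightarrow>\<^sub>0 'a) set \<Rightarrow> ('s list set list \<Rightarrow>\<^sub>0 'a) set" where
  "eps_star act n Z = (\<Union>c\<in>Z.
    bar_boundaries reflector_tuples reflector_mult (reflector_act act) n
      #>\<^bsub>bar_cycle_group reflector_tuples reflector_mult (reflector_act act) n\<^esub> eps c)"

section \<open>Well-definedness of the 0-reflector and its action\<close>

lemma equiv_nu_rel: "equiv zero_seqs nu_rel"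
proof (rule equivI)
  show "refl_on zero_seqs nu_rel" unfolding refl_on_def nu_rel_def
    by auto
  show "sym nu_rel" unfolding sym_def nu_rel_def by (auto intro: equivclp_sym)
  show "trans nu_rel" unfolding trans_def nu_rel_def
    by (auto intro: equivclp_trans)
  show "nu_rel \<subseteq> zero_seqs \<times> zero_seqs" unfolding nu_rel_def by auto
qed

lemma nu_in_zero_seqs: "nu xs ys \<Longrightarrow> xs \<in> zero_seqs \<and> ys \<in> zero_seqs"
  by (induction rule: nu.induct) auto

lemma nu_rel_induct [consumes 1, case_names refl step sym trans]:
  assumes "(xs, ys) \<in> nu_rel"
    and r: "\<And>xs. xs \<in> zero_seqs \<Longrightarrow> P xs xs"
    and s: "\<And>xs ys. nu xs ys \<Longrightarrow> P xs ys"
    and y: "\<And>xs ys. P xs ys \<Longrightarrow> P ys xs"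
    and t: "\<And>xs ys zs. P xs ys \<Longrightarrow> P ys zs \<Longrightarrow> P xs zs"
  shows "P xs ys"
proof -
  have x: "xs \<in> zero_seqs" and "(symclp nu)\<^sup>*\<^sup>* xs ys"
    using assms(1) by (auto simp: nu_rel_def equivclp_def)
  from this(2) show ?thesis
  proof (induction rule: rtranclp_induct)
    case base
    show ?case using r x .
  next
    case (step y z)
    from step.hyps(2) have "P y z" by (cases rule: symclpE) (auto intro: s y)
    with step.IH show ?case by (rule t)
  qed
qed

lemma nu_rel_refl: "x \<in> zero_seqs \<Longrightarrow> (x, x) \<in> nu_rel"
  by (simp add: nu_rel_def)

lemma nu_imp_nu_rel: "nu xs ys \<Longrightarrow> (xs, ys) \<in> nu_rel"
  unfolding nu_rel_def by (auto dest: nu_in_zero_seqs intro: r_into_equivclp)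

lemma foldl_act_nu:
  assumes "zero_module act" "nu xs ys"
  shows "foldl act a xs = foldl act a ys"
proof -
  interpret zero_module act by fact
  show ?thesis
    using assms(2)
  proof (induction rule: nu.induct)
    case (shift xs t u s ys)
    then have "t * u \<noteq> 0" "u * s \<noteq> 0" by (auto simp: zero_seqs_def)
    then show ?case by (simp flip: act_act)
  next
    case (split xs p u v q ys)
    then have "p * u \<noteq> 0" "u * v \<noteq> 0" "v * q \<noteq> 0" by (auto simp: zero_seqs_def)
    then show ?case by (simp flip: act_act)
  qed
qed

lemma reflector_act_class:
  assumes "zero_module act" "xs \<in> zero_seqs"
  shows "reflector_act act a (nu_class xs) = foldl act a xs"
proof -
  have nu_eq: "foldl act a ys = foldl act a zs" if "(ys, zs) \<in> nu_rel" for ys zs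
    using that by (induction rule: nu_rel_induct) (auto intro: foldl_act_nu[OF assms(1)])
  have "foldl act a ` nu_class xs = (\<lambda>_. foldl act a xs) ` nu_class xs"
  proof (rule image_cong[OF refl])
    fix ys assume "ys \<in> nu_class xs"
    then show "foldl act a ys = foldl act a xs"
      unfolding nu_class_def by (intro nu_eq[symmetric]) simp
  qed
  also have "\<dots> = {foldl act a xs}"
    using assms(2) by (intro image_constant[of xs]) (simp add: nu_class_def nu_rel_refl)
  finally have "(\<lambda>ys. foldl act a ys) ` nu_class xs = {foldl act a xs}" .
  then show ?thesis by (simp add: reflector_act_def)
qed

lemma seq_mult_Cons:
  "seq_mult (xs @ [x]) (y # ys) = (if x * y = 0 then xs @ x # y # ys else xs @ (x * y) # ys)"
  by (simp add: seq_mult_def)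

lemma seq_mult_closed:
  assumes "xs \<in> zero_seqs" "ys \<in> zero_seqs"
  shows "seq_mult xs ys \<in> zero_seqs"
proof -
  obtain xs' x y ys' where [simp]: "xs = xs' @ [x]" "ys = y # ys'"
    using assms by (cases xs rule: rev_cases; cases ys) (auto simp: zero_seqs_def)
  have "last xs' * x = 0 \<Longrightarrow> last xs' * (x * y) = 0"
    by (simp flip: mult.assoc)
  then show ?thesis
    using assms
    by (auto simp: seq_mult_Cons zero_seqs_def successively_append_iff successively_Cons mult.assoc)
qed

lemma seq_mult_append_left: "ys \<noteq> [] \<Longrightarrow> seq_mult (xs @ ys) zs = xs @ seq_mult ys zs"
  by (simp add: seq_mult_def butlast_append)

lemma seq_mult_append_right: "ys \<noteq> [] \<Longrightarrow> seq_mult xs (ys @ zs) = seq_mult xs ys @ zs"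
  by (simp add: seq_mult_def)

lemma nu_rel_trans: "(x, y) \<in> nu_rel \<Longrightarrow> (y, z) \<in> nu_rel \<Longrightarrow> (x, z) \<in> nu_rel"
  using equiv_nu_rel by (meson equivE transD)

lemma nu_rel_sym: "(x, y) \<in> nu_rel \<Longrightarrow> (y, x) \<in> nu_rel"
  using equiv_nu_rel by (meson equivE symD)

lemma nu_rel_shift:
  "\<lbrakk>xs @ t * u # s # ys \<in> zero_seqs; xs @ t # u * s # ys \<in> zero_seqs\<rbrakk>
    \<Longrightarrow> (xs @ t * u # s # ys, xs @ t # u * s # ys) \<in> nu_rel"
  using nu_imp_nu_rel[OF nu.shift[of xs t u s ys]] by simp

lemma nu_rel_split:
  "\<lbrakk>xs @ p # u * v # q # ys \<in> zero_seqs; xs @ p * u # v * q # ys \<in> zero_seqs\<rbrakk>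
    \<Longrightarrow> (xs @ p # u * v # q # ys, xs @ p * u # v * q # ys) \<in> nu_rel"
  using nu_imp_nu_rel[OF nu.split[of xs p u v q ys]] by simp

lemma mult_zero_assoc:
  "(x::'s::{semigroup_mult,mult_zero}) * y = 0 \<Longrightarrow> x * (y * z) = 0"
  by (simp flip: mult.assoc)

lemma seq_mult_nu_left:
  assumes "nu xs xs'" "zs \<in> zero_seqs"
  shows "(seq_mult xs zs, seq_mult xs' zs) \<in> nu_rel"
proof -
  have cl: "seq_mult xs zs \<in> zero_seqs" "seq_mult xs' zs \<in> zero_seqs"
    using nu_in_zero_seqs[OF assms(1)] assms(2) by (auto intro: seq_mult_closed)
  obtain r rs where zs: "zs = r # rs"
    using assms(2) by (cases zs) (auto simp: zero_seqs_def)
  from assms(1) show ?thesis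
  proof cases
    case (shift as t u s bs)
    show ?thesis
    proof (cases "bs = []")
      case False
      have e: "seq_mult xs zs = as @ t * u # s # seq_mult bs zs"
              "seq_mult xs' zs = as @ t # u * s # seq_mult bs zs"
        using seq_mult_append_left[OF False, of "as @ [t * u, s]" zs]
          seq_mult_append_left[OF False, of "as @ [t, u * s]" zs] shift by simp_all
      show ?thesis using cl unfolding e by (rule nu_rel_shift)
    next
      case True
      have e: "seq_mult xs zs = as @ t * u # seq_mult [s] zs"
              "seq_mult xs' zs = as @ t # seq_mult [u * s] zs"
        using seq_mult_append_left[of "[s]" "as @ [t * u]" zs]
          seq_mult_append_left[of "[u * s]" "as @ [t]" zs] shift True by simp_all
      show ?thesis
      proof (cases "s * r = 0")
        case sr: True
        then have "u * s * r = 0" by (simp add: mult.assoc)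
        with sr have e': "seq_mult xs zs = as @ t * u # s # zs"
            "seq_mult xs' zs = as @ t # u * s # zs"
          using e zs by (simp_all add: seq_mult_Cons[of "[]", simplified])
        show ?thesis using cl unfolding e' by (rule nu_rel_shift)
      next
        case sr: False
        show ?thesis
        proof (cases "u * s * r = 0")
          case usr: False
          have e': "seq_mult xs zs = as @ t * u # (s * r) # rs"
              "seq_mult xs' zs = as @ t # u * (s * r) # rs"
            using e zs sr usr by (simp_all add: seq_mult_Cons[of "[]", simplified] mult.assoc)
          show ?thesis using cl unfolding e' by (rule nu_rel_shift)
        next
          case usr: True
          have e': "seq_mult xs zs = as @ t * u # s * r # rs"
              "seq_mult xs' zs = as @ t # u * s # r # rs"
            using e zs sr usr by (simp_all add: seq_mult_Cons[of "[]", simplified])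
          show ?thesis using cl unfolding e' by (intro nu_rel_sym[OF nu_rel_split])
        qed
      qed
    qed
  next
    case (split as p u v q bs)
    show ?thesis
    proof (cases "bs = []")
      case False
      have e: "seq_mult xs zs = as @ p # u * v # q # seq_mult bs zs"
              "seq_mult xs' zs = as @ p * u # v * q # seq_mult bs zs"
        using seq_mult_append_left[OF False, of "as @ [p, u * v, q]" zs]
          seq_mult_append_left[OF False, of "as @ [p * u, v * q]" zs] split by simp_all
      show ?thesis using cl unfolding e by (rule nu_rel_split)
    next
      case True
      have e: "seq_mult xs zs = as @ p # u * v # seq_mult [q] zs"
              "seq_mult xs' zs = as @ p * u # seq_mult [v * q] zs"
        using seq_mult_append_left[of "[q]" "as @ [p, u * v]" zs]
          seq_mult_append_left[of "[v * q]" "as @ [p * u]" zs] split True by simp_all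
      show ?thesis
      proof (cases "q * r = 0")
        case qr: True
        then have "v * q * r = 0" by (simp add: mult.assoc)
        with qr have e': "seq_mult xs zs = as @ p # u * v # q # zs"
            "seq_mult xs' zs = as @ p * u # v * q # zs"
          using e zs by (simp_all add: seq_mult_Cons[of "[]", simplified])
        show ?thesis using cl unfolding e' by (rule nu_rel_split)
      next
        case qr: False
        show ?thesis
        proof (cases "v * q * r = 0")
          case vqr: False
          have e': "seq_mult xs zs = as @ p # u * v # (q * r) # rs"
              "seq_mult xs' zs = as @ p * u # v * (q * r) # rs"
            using e zs qr vqr by (simp_all add: seq_mult_Cons[of "[]", simplified] mult.assoc)
          show ?thesis using cl unfolding e' by (rule nu_rel_split)
        next
          case vqr: True
          have e': "seq_mult xs zs = as @ p # u * v # q * r # rs"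
              "seq_mult xs' zs = as @ p * u # v * q # r # rs"
            using e zs qr vqr by (simp_all add: seq_mult_Cons[of "[]", simplified])
          have m: "as @ p * u # v # q * r # rs \<in> zero_seqs"
            using cl vqr unfolding e'
            by (auto simp: zero_seqs_def successively_append_iff successively_Cons mult.assoc)
          have "(as @ p * u # v # q * r # rs, as @ p # u * v # q * r # rs) \<in> nu_rel"
            using cl m unfolding e' by (intro nu_rel_shift)
          moreover have "(as @ p * u # v * q # r # rs, as @ p * u # v # q * r # rs) \<in> nu_rel"
            using cl m nu_rel_shift[of "as @ [p * u]" v q r rs] unfolding e' by simp
          ultimately show ?thesis unfolding e' by (blast intro: nu_rel_sym nu_rel_trans)
        qed
      qed
    qed
  qed
qed

lemma seq_mult_nu_right:
  assumes "nu xs xs'" "zs \<in> zero_seqs"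
  shows "(seq_mult zs xs, seq_mult zs xs') \<in> nu_rel"
proof -
  have cl: "seq_mult zs xs \<in> zero_seqs" "seq_mult zs xs' \<in> zero_seqs"
    using nu_in_zero_seqs[OF assms(1)] assms(2) by (auto intro: seq_mult_closed)
  obtain r rs where zs: "zs = rs @ [r]"
    using assms(2) by (cases zs rule: rev_cases) (auto simp: zero_seqs_def)
  from assms(1) show ?thesis
  proof cases
    case (shift as t u s bs)
    show ?thesis
    proof (cases "as = []")
      case False
      have e: "seq_mult zs xs = seq_mult zs as @ t * u # s # bs"
              "seq_mult zs xs' = seq_mult zs as @ t # u * s # bs"
        using seq_mult_append_right[OF False] shift by simp_all
      show ?thesis using cl unfolding e by (rule nu_rel_shift)
    next
      case True
      consider "r * t = 0" | "r * t \<noteq> 0" "r * t * u \<noteq> 0" | "r * t \<noteq> 0" "r * t * u = 0" by blast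
      then show ?thesis
      proof cases
        case 1
        have e: "seq_mult zs xs = (rs @ [r]) @ t * u # s # bs"
                "seq_mult zs xs' = (rs @ [r]) @ t # u * s # bs"
          using shift True zs 1 mult_zero_assoc[OF 1] by (simp_all add: seq_mult_Cons)
        show ?thesis using cl unfolding e by (rule nu_rel_shift)
      next
        case 2
        have e: "seq_mult zs xs = rs @ (r * t) * u # s # bs"
                "seq_mult zs xs' = rs @ r * t # u * s # bs"
          using shift True zs 2 by (simp_all add: seq_mult_Cons mult.assoc)
        show ?thesis using cl unfolding e by (rule nu_rel_shift)
      next
        case 3
        have e: "seq_mult zs xs = rs @ r # t * u # s # bs"
                "seq_mult zs xs' = rs @ r * t # u * s # bs"
          using shift True zs 3 by (simp_all add: seq_mult_Cons mult.assoc)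
        show ?thesis using cl unfolding e by (rule nu_rel_split)
      qed
    qed
  next
    case (split as p u v q bs)
    show ?thesis
    proof (cases "as = []")
      case False
      have e: "seq_mult zs xs = seq_mult zs as @ p # u * v # q # bs"
              "seq_mult zs xs' = seq_mult zs as @ p * u # v * q # bs"
        using seq_mult_append_right[OF False] split by simp_all
      show ?thesis using cl unfolding e by (rule nu_rel_split)
    next
      case True
      consider "r * p = 0" | "r * p \<noteq> 0" "r * p * u \<noteq> 0" | "r * p \<noteq> 0" "r * p * u = 0" by blast
      then show ?thesis
      proof cases
        case 1
        have e: "seq_mult zs xs = (rs @ [r]) @ p # u * v # q # bs"
                "seq_mult zs xs' = (rs @ [r]) @ p * u # v * q # bs"
          using split True zs 1 mult_zero_assoc[OF 1] by (simp_all add: seq_mult_Cons)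
        show ?thesis using cl unfolding e by (rule nu_rel_split)
      next
        case 2
        have e: "seq_mult zs xs = rs @ r * p # u * v # q # bs"
                "seq_mult zs xs' = rs @ (r * p) * u # v * q # bs"
          using split True zs 2 by (simp_all add: seq_mult_Cons mult.assoc)
        show ?thesis using cl unfolding e by (rule nu_rel_split)
      next
        case 3
        have e: "seq_mult zs xs = rs @ r * p # u * v # q # bs"
                "seq_mult zs xs' = rs @ r # p * u # v * q # bs"
          using split True zs 3 by (simp_all add: seq_mult_Cons mult.assoc)
        have nz: "u \<noteq> 0" "v \<noteq> 0" "q \<noteq> 0"
          using cl unfolding e by (auto simp: zero_seqs_def)
        have m: "rs @ r * p # u # v * q # bs \<in> zero_seqs"
          using cl 3 nz unfolding e
          by (auto simp: zero_seqs_def successively_append_iff successively_Cons mult.assoc)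
        have "(rs @ r * p # u * v # q # bs, rs @ r * p # u # v * q # bs) \<in> nu_rel"
          using cl m nu_rel_shift[of "rs @ [r * p]" u v q bs] unfolding e by simp
        moreover have "(rs @ r * p # u # v * q # bs, rs @ r # p * u # v * q # bs) \<in> nu_rel"
          using cl m unfolding e by (intro nu_rel_shift)
        ultimately show ?thesis unfolding e by (blast intro: nu_rel_trans)
      qed
    qed
  qed
qed

lemma seq_mult_cong:
  assumes "(xs, xs') \<in> nu_rel" "(ys, ys') \<in> nu_rel"
  shows "(seq_mult xs ys, seq_mult xs' ys') \<in> nu_rel"
proof -
  have z: "xs' \<in> zero_seqs" "ys \<in> zero_seqs" using assms by (auto simp: nu_rel_def)
  have "(seq_mult xs ys, seq_mult xs' ys) \<in> nu_rel"
    using assms(1)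
    by (induction rule: nu_rel_induct)
      (auto intro: seq_mult_nu_left nu_rel_refl nu_rel_sym nu_rel_trans seq_mult_closed z)
  moreover have "(seq_mult xs' ys, seq_mult xs' ys') \<in> nu_rel"
    using assms(2)
    by (induction rule: nu_rel_induct)
      (auto intro: seq_mult_nu_right nu_rel_refl nu_rel_sym nu_rel_trans seq_mult_closed z)
  ultimately show ?thesis by (rule nu_rel_trans)
qed

lemma reflector_mult_class:
  assumes "xs \<in> zero_seqs" "ys \<in> zero_seqs"
  shows "reflector_mult (nu_class xs) (nu_class ys) = nu_class (seq_mult xs ys)"
proof -
  have self: "xs \<in> nu_class xs" "ys \<in> nu_class ys"
    using assms by (simp_all add: nu_class_def nu_rel_refl)
  have "nu_class (seq_mult xs' ys') = nu_class (seq_mult xs ys)"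
    if "xs' \<in> nu_class xs" "ys' \<in> nu_class ys" for xs' ys'
    using that seq_mult_cong nu_rel_sym equiv_class_eq[OF equiv_nu_rel]
    unfolding nu_class_def by blast
  then show ?thesis
    unfolding reflector_mult_def using self by blast
qed

lemma seq_mult_assoc:
  assumes "xs \<in> zero_seqs" "ys \<in> zero_seqs" "zs \<in> zero_seqs"
  shows "(seq_mult (seq_mult xs ys) zs, seq_mult xs (seq_mult ys zs)) \<in> nu_rel"
proof -
  have cl: "seq_mult (seq_mult xs ys) zs \<in> zero_seqs" "seq_mult xs (seq_mult ys zs) \<in> zero_seqs"
    using assms by (auto intro: seq_mult_closed)
  obtain xs' x z zs' where xz: "xs = xs' @ [x]" "zs = z # zs'"
    using assms by (cases xs rule: rev_cases; cases zs) (auto simp: zero_seqs_def)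
  obtain y ys' where y: "ys = y # ys'" using assms by (cases ys) (auto simp: zero_seqs_def)
  show ?thesis
  proof (cases ys' rule: rev_cases)
    case (snoc ws w)
    have "seq_mult (seq_mult xs ys) zs = seq_mult xs (seq_mult ys zs)"
      unfolding seq_mult_def xz y snoc by (auto simp: butlast_append)
    then show ?thesis using nu_rel_refl cl by simp
  next
    case Nil
    consider "x * y = 0" "y * z = 0" | "x * y \<noteq> 0" "y * z = 0" | "x * y = 0" "y * z \<noteq> 0"
      | "x * y \<noteq> 0" "y * z \<noteq> 0" by blast
    then show ?thesis
    proof cases
      case 1
      then have "seq_mult (seq_mult xs ys) zs = seq_mult xs (seq_mult ys zs)"
        unfolding seq_mult_def xz y Nil by auto
      then show ?thesis using nu_rel_refl cl by simp
    next
      case 2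
      then have "seq_mult (seq_mult xs ys) zs = seq_mult xs (seq_mult ys zs)"
        unfolding seq_mult_def xz y Nil by (auto simp: mult.assoc)
      then show ?thesis using nu_rel_refl cl by simp
    next
      case 3
      then have "x * (y * z) = 0" by (rule_tac mult_zero_assoc)
      with 3 have "seq_mult (seq_mult xs ys) zs = seq_mult xs (seq_mult ys zs)"
        unfolding seq_mult_def xz y Nil by (auto simp: butlast_append)
      then show ?thesis using nu_rel_refl cl by simp
    next
      case 4
      show ?thesis
      proof (cases "x * y * z = 0")
        case False
        with 4 have "seq_mult (seq_mult xs ys) zs = seq_mult xs (seq_mult ys zs)"
          unfolding seq_mult_def xz y Nil by (auto simp: mult.assoc)
        then show ?thesis using nu_rel_refl cl by simp
      next
        case True
        with 4 have e: "seq_mult (seq_mult xs ys) zs = xs' @ x * y # z # zs'"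
          "seq_mult xs (seq_mult ys zs) = xs' @ x # y * z # zs'"
          unfolding seq_mult_def xz y Nil by (auto simp: mult.assoc)
        show ?thesis using cl unfolding e by (rule nu_rel_shift)
      qed
    qed
  qed
qed

text \<open>Hence the 0-reflector is a semigroup acting on every 0-module.\<close>

lemma reflectorE:
  assumes "X \<in> reflector"
  obtains xs where "xs \<in> zero_seqs" "X = nu_class xs"
  using assms unfolding reflector_def nu_class_def by (auto elim: quotientE)

lemma nu_class_in_reflector: "xs \<in> zero_seqs \<Longrightarrow> nu_class xs \<in> reflector"
  unfolding reflector_def nu_class_def by (rule quotientI)

lemma reflector_mult_closed:
  "X \<in> reflector \<Longrightarrow> Y \<in> reflector \<Longrightarrow> reflector_mult X Y \<in> reflector"
  by (elim reflectorE) (simp add: reflector_mult_class nu_class_in_reflector seq_mult_closed)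

lemma reflector_mult_assoc:
  assumes "X \<in> reflector" "Y \<in> reflector" "Z \<in> reflector"
  shows "reflector_mult (reflector_mult X Y) Z = reflector_mult X (reflector_mult Y Z)"
proof -
  obtain xs ys zs where z: "xs \<in> zero_seqs" "ys \<in> zero_seqs" "zs \<in> zero_seqs"
    and "X = nu_class xs" "Y = nu_class ys" "Z = nu_class zs"
    using assms by (meson reflectorE)
  then show ?thesis
    using equiv_class_eq[OF equiv_nu_rel seq_mult_assoc[OF z]]
    by (simp add: reflector_mult_class seq_mult_closed nu_class_def[symmetric])
qed

lemma reflector_act_mult:
  assumes "zero_module act" "X \<in> reflector" "Y \<in> reflector"
  shows "reflector_act act (reflector_act act a X) Y = reflector_act act a (reflector_mult X Y)"
proof -
  interpret zero_module act by fact
  obtain xs ys where z: "xs \<in> zero_seqs" "ys \<in> zero_seqs"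
    and XY: "X = nu_class xs" "Y = nu_class ys"
    using assms by (meson reflectorE)
  obtain xs' x y ys' where xy: "xs = xs' @ [x]" "ys = y # ys'"
    using z by (cases xs rule: rev_cases; cases ys) (auto simp: zero_seqs_def)
  have "foldl act (foldl act a xs) ys = foldl act a (seq_mult xs ys)"
    unfolding xy seq_mult_Cons by (simp add: act_act)
  then show ?thesis
    using z by (simp add: XY reflector_mult_class reflector_act_class[OF assms(1)] seq_mult_closed)
qed

lemma reflector_act_add:
  assumes "zero_module act" "X \<in> reflector"
  shows "reflector_act act (a + b) X = reflector_act act a X + reflector_act act b X"
proof -
  interpret zero_module act by fact
  obtain xs where xs: "xs \<in> zero_seqs" and X: "X = nu_class xs"
    using reflectorE[OF assms(2)] by blast
  then have "0 \<notin> set xs" by (simp add: zero_seqs_def)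
  moreover have "foldl act (a + b) zs = foldl act a zs + foldl act b zs" if "0 \<notin> set zs" for zs
    using that by (induction zs arbitrary: a b) (simp_all add: act_add)
  ultimately show ?thesis
    unfolding X reflector_act_class[OF assms(1) xs] by blast
qed

end

theory Submission
  imports Defs
begin

text \<open>
  Categoricity at zero makes the relation \<open>nu\<close> empty: each of its clauses needs a product \<open>xyz = 0\<close> with
  \<open>xy \<noteq> 0\<close> and \<open>yz \<noteq> 0\<close> (\<open>no_nu\<close>). So the 0-reflector is a semigroup of words: sequences of nonzero
  letters in which neighbours multiply to zero, multiplied by concatenation, except that the two letters
  at the seam are multiplied if their product is nonzero. Categoricity also says that a tuple has a
  nonzero product if and only if the products of its neighbours are nonzero. Hence \<open>eps\<close> embeds
  the 0-complex into the bar complex of words as the part spanned by the good tuples, the tuples of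
  one-letter words in which neighbouring letters have nonzero products.

  It then suffices that the quotient by this subcomplex is acyclic (\<open>relative_acyclicity\<close>), for which
  the bar complex is reduced by a discrete Morse matching. Read a tuple that is not good from the left up
  to the first entry that violates goodness. Either the entry before it is a letter whose product with
  the next letter is zero, and the two entries can be multiplied by concatenation; or the violating
  entry is a word of length at least two, and it can be split after its first letter. The two operations
  are inverse to each other and match the tuples of the first kind, called upper, with those of the
  second kind, called lower, one degree below. The boundary of an upper tuple consists of the matched
  lower tuple with coefficient plus or minus one, of upper and good tuples, and of the face
  that drops the first entry and has fewer letters (\<open>upper_inner_faces\<close>).

  By induction on the number of letters, every chain can therefore be freed of lower tuples by adding a
  boundary (\<open>reduce_chain\<close>), and a chain of upper and good tuples whose boundary is good has no upper
  tuples, since the lower partner of an upper tuple with the most letters would not cancel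
  (\<open>upper_free\<close>).

  All this is carried out for tuples of words. The complex of words is identified with the bar
  complex of the 0-reflector by \<open>w \<mapsto> \<langle>w\<rangle> = {w}\<close>.
\<close>

section \<open>Additive maps of chains\<close>

text \<open>
  The boundary maps and \<open>eps\<close> are instances of this extension of a map given on the generators \<open>a[k]\<close>.
\<close>

definition lin_ext :: "('k \<Rightarrow> 'a::zero \<Rightarrow> 'b::comm_monoid_add) \<Rightarrow> ('k \<Rightarrow>\<^sub>0 'a) \<Rightarrow> 'b" where
  "lin_ext f c = (\<Sum>k\<in>Poly_Mapping.keys c. f k (Poly_Mapping.lookup c k))"

definition push :: "('k \<Rightarrow> 'l) \<Rightarrow> ('k \<Rightarrow>\<^sub>0 'a::comm_monoid_add) \<Rightarrow> ('l \<Rightarrow>\<^sub>0 'a)" where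
  "push g = lin_ext (\<lambda>k. Poly_Mapping.single (g k))"

definition map_coeff :: "('a \<Rightarrow> 'b) \<Rightarrow> ('k \<Rightarrow>\<^sub>0 'a::comm_monoid_add) \<Rightarrow> ('k \<Rightarrow>\<^sub>0 'b::comm_monoid_add)" where
  "map_coeff h = lin_ext (\<lambda>k a. Poly_Mapping.single k (h a))"

lemma chain_expansion:
  fixes c :: "'k \<Rightarrow>\<^sub>0 'a::ab_group_add"
  shows
  "(\<Sum>k\<in>Poly_Mapping.keys c. Poly_Mapping.single k (Poly_Mapping.lookup c k)) = c"
proof (rule poly_mapping_eqI)
  fix k
  have "Poly_Mapping.lookup (\<Sum>k\<in>Poly_Mapping.keys c. Poly_Mapping.single k (Poly_Mapping.lookup c k)) k
     = (\<Sum>j\<in>Poly_Mapping.keys c. if j = k then Poly_Mapping.lookup c k else 0)"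
    unfolding lookup_sum by (rule sum.cong) (auto simp: lookup_single when_def)
  also have "\<dots> = Poly_Mapping.lookup c k"
    by (auto simp: sum.delta in_keys_iff)
  finally show "Poly_Mapping.lookup (\<Sum>k\<in>Poly_Mapping.keys c.
      Poly_Mapping.single k (Poly_Mapping.lookup c k)) k = Poly_Mapping.lookup c k" .
qed

text \<open>
  Every chain supported in \<open>K\<close> is a sum of generators supported in \<open>K\<close>, so an additive identity
  between maps of chains needs checking on generators only.
\<close>

lemma chain_induct [consumes 1, case_names zero single add]:
  fixes c :: "'k \<Rightarrow>\<^sub>0 'a::ab_group_add"
  assumes "Poly_Mapping.keys c \<subseteq> K"
    and "P 0"
    and "\<And>k a. k \<in> K \<Longrightarrow> P (Poly_Mapping.single k a)"
    and "\<And>c d. \<lbrakk>Poly_Mapping.keys c \<subseteq> K; Poly_Mapping.keys d \<subseteq> K; P c; P d\<rbrakk> \<Longrightarrow> P (c + d)"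
  shows "P c"
proof -
  let ?s = "\<lambda>k. Poly_Mapping.single k (Poly_Mapping.lookup c k)"
  have "finite F \<Longrightarrow> F \<subseteq> K \<Longrightarrow> P (sum ?s F) \<and> Poly_Mapping.keys (sum ?s F) \<subseteq> K" for F
  proof (induction F rule: finite_induct)
    case (insert k F)
    then have "Poly_Mapping.keys (?s k) \<subseteq> K" by simp
    with insert assms(4)[of "?s k" "sum ?s F"] keys_add[of "?s k" "sum ?s F"] show ?case
      by (auto simp: assms(3))
  qed (use assms in auto)
  from this[of "Poly_Mapping.keys c"] show ?thesis using assms(1) by (simp add: chain_expansion)
qed

lemma lin_ext_zero [simp]: "lin_ext f 0 = 0"
  by (simp add: lin_ext_def)

lemma lin_ext_single:
  "f k 0 = 0 \<Longrightarrow> lin_ext f (Poly_Mapping.single k a) = f k a"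
  by (auto simp: lin_ext_def)

lemma lin_ext_superset:
  assumes "Poly_Mapping.keys c \<subseteq> K" "finite K" "\<And>k. f k 0 = 0"
  shows "lin_ext f c = (\<Sum>k\<in>K. f k (Poly_Mapping.lookup c k))"
  unfolding lin_ext_def by (rule sum.mono_neutral_left) (use assms in \<open>auto simp: in_keys_iff\<close>)

definition additive_gen :: "('k \<Rightarrow> 'a::ab_group_add \<Rightarrow> 'b::ab_group_add) \<Rightarrow> bool" where
  "additive_gen f \<longleftrightarrow> (\<forall>k a b. f k (a + b) = f k a + f k b)"

lemma additive_gen_zero: "additive_gen f \<Longrightarrow> f k 0 = 0"
  unfolding additive_gen_def by (metis add_cancel_right_right)

lemma lin_ext_single_additive: "additive_gen f \<Longrightarrow> lin_ext f (Poly_Mapping.single k a) = f k a"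
  by (simp add: lin_ext_single additive_gen_zero)

lemma lin_ext_add:
  assumes "additive_gen f"
  shows "lin_ext f (c + d) = lin_ext f c + lin_ext f d"
proof -
  let ?K = "Poly_Mapping.keys c \<union> Poly_Mapping.keys d"
  have z: "\<And>k. f k 0 = 0" using assms by (rule additive_gen_zero)
  have "lin_ext f (c + d) = (\<Sum>k\<in>?K. f k (Poly_Mapping.lookup (c + d) k))"
    by (rule lin_ext_superset) (use keys_add[of c d] z in auto)
  also have "\<dots> = (\<Sum>k\<in>?K. f k (Poly_Mapping.lookup c k)) + (\<Sum>k\<in>?K. f k (Poly_Mapping.lookup d k))"
    using assms by (simp add: lookup_add additive_gen_def sum.distrib)
  also have "\<dots> = lin_ext f c + lin_ext f d"
    by (simp add: lin_ext_superset[of c ?K] lin_ext_superset[of d ?K] z)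
  finally show ?thesis .
qed

lemma lin_ext_uminus:
  assumes "additive_gen f" shows "lin_ext f (- c) = - lin_ext f c"
proof -
  have "lin_ext f c + lin_ext f (- c) = 0"
    using lin_ext_add[OF assms, of c "- c"] by simp
  then show ?thesis by (simp add: eq_neg_iff_add_eq_0 add.commute)
qed

lemma lin_ext_diff:
  "additive_gen f \<Longrightarrow> lin_ext f (c - d) = lin_ext f c - lin_ext f d"
  using lin_ext_add[of f c "- d"] by (simp add: lin_ext_uminus)

lemma keys_lin_ext: "Poly_Mapping.keys (lin_ext f c) \<subseteq> (\<Union>k\<in>Poly_Mapping.keys c. Poly_Mapping.keys (f k (Poly_Mapping.lookup c k)))"
  unfolding lin_ext_def by (rule keys_sum)

lemma additive_gen_single: "additive_gen (\<lambda>k. Poly_Mapping.single (g k))"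
  by (simp add: additive_gen_def single_add)

lemma push_zero [simp]: "push g 0 = 0"
  by (simp add: push_def)

lemma push_single [simp]: "push g (Poly_Mapping.single k a) = Poly_Mapping.single (g k) a"
  by (simp add: push_def lin_ext_single)

lemma push_add: "push g (c + d) = push g c + push g d" for c :: "'k \<Rightarrow>\<^sub>0 'a::ab_group_add"
  by (simp add: push_def lin_ext_add additive_gen_single)

lemma push_uminus: "push g (- c) = - push g c" for c :: "'k \<Rightarrow>\<^sub>0 'a::ab_group_add"
  by (simp add: push_def lin_ext_uminus additive_gen_single)

lemma push_diff: "push g (c - d) = push g c - push g d" for c :: "'k \<Rightarrow>\<^sub>0 'a::ab_group_add"
  by (simp add: push_def lin_ext_diff additive_gen_single)

lemma keys_push: "Poly_Mapping.keys (push g c) \<subseteq> g ` Poly_Mapping.keys c"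
proof -
  have "Poly_Mapping.keys (Poly_Mapping.single (g k) (Poly_Mapping.lookup c k)) \<subseteq> {g k}" for k
    by simp
  then show ?thesis
    using keys_lin_ext[of "\<lambda>k. Poly_Mapping.single (g k)" c] unfolding push_def by blast
qed

lemma push_push:
  fixes c :: "'k \<Rightarrow>\<^sub>0 'a::ab_group_add"
  shows "push h (push g c) = push (\<lambda>k. h (g k)) c"
  by (rule chain_induct[of c UNIV]) (auto simp: push_add)

lemma push_id:
  fixes c :: "'k \<Rightarrow>\<^sub>0 'a::ab_group_add"
  assumes "\<And>k. k \<in> Poly_Mapping.keys c \<Longrightarrow> g k = k"
  shows "push g c = c"
  unfolding push_def lin_ext_def using assms chain_expansion[of c] by simp

text \<open>
  Injectivity of the comparison maps is always used in this form: a map of tuples that has a left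
  inverse on the support of a chain can be undone on that chain.
\<close>

lemma push_left_inverse:
  fixes c :: "'k \<Rightarrow>\<^sub>0 'a::ab_group_add"
  assumes "\<And>k. k \<in> Poly_Mapping.keys c \<Longrightarrow> h (g k) = k"
  shows "push h (push g c) = c"
  unfolding push_push by (rule push_id[OF assms])

section \<open>Isomorphisms of quotients\<close>

definition add_monoid :: "'a::ab_group_add set \<Rightarrow> 'a monoid" where
  "add_monoid Z = \<lparr>carrier = Z, monoid.mult = (+), one = 0\<rparr>"

lemma add_monoid_simps [simp]:
  "carrier (add_monoid Z) = Z" "x \<otimes>\<^bsub>add_monoid Z\<^esub> y = x + y" "\<one>\<^bsub>add_monoid Z\<^esub> = 0"
  by (simp_all add: add_monoid_def)

definition add_subgroup :: "'a::ab_group_add set \<Rightarrow> bool" where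
  "add_subgroup Z \<longleftrightarrow> 0 \<in> Z \<and> (\<forall>x\<in>Z. \<forall>y\<in>Z. x - y \<in> Z)"

lemma add_subgroup_uminus: "add_subgroup Z \<Longrightarrow> x \<in> Z \<Longrightarrow> - x \<in> Z"
  unfolding add_subgroup_def by (metis diff_0)

lemma add_subgroup_add: "add_subgroup Z \<Longrightarrow> x \<in> Z \<Longrightarrow> y \<in> Z \<Longrightarrow> x + y \<in> Z"
  using add_subgroup_uminus unfolding add_subgroup_def by (metis diff_minus_eq_add)

lemma add_subgroup_kernel_image:
  assumes "add_subgroup D" and f: "\<And>x y. x \<in> D \<Longrightarrow> y \<in> D \<Longrightarrow> f (x - y) = f x - f y"
  shows "add_subgroup {x \<in> D. f x = 0}" "add_subgroup (f ` D)"
proof -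
  have D: "0 \<in> D" "\<And>x y. x \<in> D \<Longrightarrow> y \<in> D \<Longrightarrow> x - y \<in> D"
    using assms(1) by (auto simp: add_subgroup_def)
  have f0: "f 0 = 0" using f[OF D(1) D(1)] by simp
  show "add_subgroup {x \<in> D. f x = 0}"
    using D f f0 by (auto simp: add_subgroup_def)
  have "f x - f y \<in> f ` D" if "x \<in> D" "y \<in> D" for x y
    using that D(2) f by (intro image_eqI[of _ _ "x - y"]) auto
  moreover have "0 \<in> f ` D" using D(1) f0 by (intro image_eqI[of _ _ 0]) auto
  ultimately show "add_subgroup (f ` D)" by (auto simp: add_subgroup_def)
qed

lemma add_subgroup_bar_chains: "add_subgroup (bar_chains K n)"
proof -
  have "Poly_Mapping.keys (c - d) \<subseteq> K n"
    if "Poly_Mapping.keys c \<subseteq> K n" "Poly_Mapping.keys d \<subseteq> K n" for c d :: "'a list \<Rightarrow>\<^sub>0 'b"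
    using that keys_diff[of c d] by blast
  then show ?thesis by (auto simp: add_subgroup_def bar_chains_def)
qed

lemma comm_group_add_monoid:
  assumes "add_subgroup Z" shows "comm_group (add_monoid Z)"
proof (rule comm_groupI)
  fix x assume x: "x \<in> carrier (add_monoid Z)"
  then show "\<exists>y\<in>carrier (add_monoid Z). y \<otimes>\<^bsub>add_monoid Z\<^esub> x = \<one>\<^bsub>add_monoid Z\<^esub>"
    using add_subgroup_uminus[OF assms] by (intro bexI[of _ "- x"]) auto
qed (use assms add_subgroup_add[OF assms] in \<open>auto simp: add_subgroup_def add_ac\<close>)

lemma normal_add_monoid:
  assumes "add_subgroup Z" "add_subgroup B" "B \<subseteq> Z"
  shows "B \<lhd> add_monoid Z"
proof -
  interpret comm_group "add_monoid Z" by (rule comm_group_add_monoid[OF assms(1)])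
  have inv: "inv\<^bsub>add_monoid Z\<^esub> x = - x" if "x \<in> Z" for x
    by (rule inv_equality) (use that add_subgroup_uminus[OF assms(1)] in auto)
  have "subgroup B (add_monoid Z)"
  proof (rule subgroupI)
    show "inv\<^bsub>add_monoid Z\<^esub> a \<in> B" if "a \<in> B" for a
      using that assms(3) add_subgroup_uminus[OF assms(2)] inv by auto
  qed (use assms add_subgroup_add[OF assms(2)] in \<open>auto simp: add_subgroup_def\<close>)
  then show ?thesis by (rule subgroup_imp_normal)
qed

text \<open>
  The last two hypotheses on \<open>f\<close> say that \<open>B\<close> is the kernel of the composite of \<open>f\<close> with the
  projection modulo \<open>B'\<close>, and that this composite is onto, so this is the first isomorphism theorem.
  The union in the conclusion is over equal cosets; this is how \<open>eps_star\<close> is written.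
\<close>

lemma quotient_map_iso:
  assumes Z: "add_subgroup Z" "add_subgroup B" "B \<subseteq> Z"
    and Z': "add_subgroup Z'" "add_subgroup B'" "B' \<subseteq> Z'"
    and f: "f ` Z \<subseteq> Z'" "\<And>x y. x \<in> Z \<Longrightarrow> y \<in> Z \<Longrightarrow> f (x + y) = f x + f y"
    and inj: "\<And>x. x \<in> Z \<Longrightarrow> f x \<in> B' \<longleftrightarrow> x \<in> B"
    and surj: "\<And>y. y \<in> Z' \<Longrightarrow> \<exists>x\<in>Z. y - f x \<in> B'"
  shows "(\<lambda>X. \<Union>x\<in>X. B' #>\<^bsub>add_monoid Z'\<^esub> f x) \<in> iso (add_monoid Z Mod B) (add_monoid Z' Mod B')"
proof -
  let ?G = "add_monoid Z" and ?G' = "add_monoid Z'"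
  let ?h = "\<lambda>x. B' #>\<^bsub>?G'\<^esub> f x"
  interpret G: comm_group ?G by (rule comm_group_add_monoid[OF Z(1)])
  interpret G': comm_group ?G' by (rule comm_group_add_monoid[OF Z'(1)])
  interpret B: normal B ?G by (rule normal_add_monoid[OF Z])
  interpret B': normal B' ?G' by (rule normal_add_monoid[OF Z'])
  interpret Q': group "?G' Mod B'" by (rule B'.factorgroup_is_group)
  have "f \<in> hom ?G ?G'" using f by (auto simp: hom_def)
  then have "?h \<in> hom ?G (?G' Mod B')"
    using hom_compose[OF _ B'.r_coset_hom_Mod] by (simp add: comp_def)
  then interpret h: group_hom ?G "?G' Mod B'" ?h
    by (simp add: group_hom_def group_hom_axioms_def G.is_group Q'.is_group)
  have kernel: "kernel ?G (?G' Mod B') ?h = B"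
  proof -
    have "?h x = B' \<longleftrightarrow> x \<in> B" if "x \<in> Z" for x
    proof -
      have "f x \<in> Z'" using f(1) that by auto
      then have "?h x = B' \<longleftrightarrow> f x \<in> B'"
        using G'.rcos_self[of "f x" B'] B'.subgroup_axioms B'.rcos_const by auto
      with inj[OF that] show ?thesis by simp
    qed
    then show ?thesis using Z(3) by (auto simp: kernel_def)
  qed
  have surj': "?h ` carrier ?G = carrier (?G' Mod B')"
  proof (rule antisym)
    show "?h ` carrier ?G \<subseteq> carrier (?G' Mod B')" using h.hom_closed by blast
    show "carrier (?G' Mod B') \<subseteq> ?h ` carrier ?G"
    proof
      fix Y assume "Y \<in> carrier (?G' Mod B')"
      then obtain y where y: "y \<in> Z'" "Y = B' #>\<^bsub>?G'\<^esub> y" by (auto simp: carrier_FactGroup)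
      obtain x where x: "x \<in> Z" "y - f x \<in> B'" using surj[OF y(1)] by blast
      then have "y \<in> B' #>\<^bsub>?G'\<^esub> f x"
        by (auto simp: r_coset_def intro!: bexI[of _ "y - f x"])
      then have "Y = ?h x"
        using G'.repr_independence[of y B' "f x"] x f(1) B'.subgroup_axioms y by auto
      with x show "Y \<in> ?h ` carrier ?G" by auto
    qed
  qed
  have iso: "(\<lambda>X. the_elem (?h ` X)) \<in> iso (?G Mod B) (?G' Mod B')"
    using h.FactGroup_iso_set[OF surj'] unfolding kernel .
  show ?thesis
  proof (rule group.iso_eq[OF B.factorgroup_is_group iso])
    fix X assume X: "X \<in> carrier (?G Mod B)"
    then obtain x where x: "x \<in> Z" "X = B #>\<^bsub>?G\<^esub> x" by (auto simp: carrier_FactGroup)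
    have "?h ` X = {?h x}"
    proof -
      have "?h (b + x) = ?h x" if "b \<in> B" for b
      proof -
        have "b \<in> Z" using that Z(3) by auto
        then have "f (b + x) = f b + f x" "f b \<in> B'" "f x \<in> Z'"
          using f x that inj by auto
        then have "f (b + x) \<in> ?h x"
          by (auto simp: r_coset_def)
        then show ?thesis
          using G'.repr_independence[of "f (b + x)" B' "f x"] \<open>f x \<in> Z'\<close> B'.subgroup_axioms by simp
      qed
      then have "?h y = ?h x" if "y \<in> X" for y
        using that unfolding x(2) by (auto simp: r_coset_def)
      moreover have "x \<in> X"
        using x Z(2) by (auto simp: r_coset_def add_subgroup_def intro!: bexI[of _ 0])
      ultimately show ?thesis by blast
    qed
    then show "(\<Union>x\<in>X. ?h x) = the_elem (?h ` X)" by simp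
  qed
qed

section \<open>The bar boundary, recursively\<close>

text \<open>
  All faces of \<open>a[x\<^sub>1, ..., x\<^sub>n]\<close> except the one that uses the action, with the sign reversed. Merging
  the first two entries comes with sign \<open>+\<close>, and every other face keeps the first entry and is, up to
  the change of sign caused by the shift of position, a face of the remaining tuple. This recursion
  replaces the positions in \<open>bar_boundary_gen\<close>, so that proofs can go by induction on the tuple.
\<close>

fun inner_faces :: "('x \<Rightarrow> 'x \<Rightarrow> 'x) \<Rightarrow> 'x list \<Rightarrow> 'a::ab_group_add \<Rightarrow> ('x list \<Rightarrow>\<^sub>0 'a)" where
  "inner_faces mul [] a = 0"
| "inner_faces mul [x] a = Poly_Mapping.single [] a"
| "inner_faces mul (x # y # xs) a =
     Poly_Mapping.single (mul x y # xs) a - push ((#) x) (inner_faces mul (y # xs) a)"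

fun first_face :: "('a::ab_group_add \<Rightarrow> 'x \<Rightarrow> 'a) \<Rightarrow> 'x list \<Rightarrow> 'a \<Rightarrow> ('x list \<Rightarrow>\<^sub>0 'a)" where
  "first_face act [] a = 0"
| "first_face act (x # xs) a = Poly_Mapping.single xs (act a x)"

lemma push_sum:
  fixes F :: "'i \<Rightarrow> ('k \<Rightarrow>\<^sub>0 'a::ab_group_add)"
  shows "push g (\<Sum>i\<in>I. F i) = (\<Sum>i\<in>I. push g (F i))"
  by (induction I rule: infinite_finite_induct) (simp_all add: push_add)

lemma push_alt_sign: "push g (alt_sign i c) = alt_sign i (push g c)" for c :: "'k \<Rightarrow>\<^sub>0 'a::ab_group_add"
  by (simp add: alt_sign_def push_uminus)

text \<open>
  The face that merges positions \<open>i + 1\<close>, \<open>i + 2\<close> of \<open>x # y # xs\<close> is \<open>x\<close> followed by the face that merges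
  positions \<open>i\<close>, \<open>i + 1\<close> of \<open>y # xs\<close>, with the opposite sign.
\<close>

lemma alternating_inner_faces:
  "(\<Sum>i = 1..length xs. alt_sign i (Poly_Mapping.single (merge_at mul i (x # xs)) a))
     + alt_sign (Suc (length xs)) (Poly_Mapping.single (butlast (x # xs)) a)
   = - inner_faces mul (x # xs) a"
proof (induction xs arbitrary: x)
  case Nil
  show ?case by (simp add: alt_sign_def)
next
  case (Cons y xs)
  let ?f = "\<lambda>i. alt_sign i (Poly_Mapping.single (merge_at mul i (x # y # xs)) a)"
  let ?g = "\<lambda>i. alt_sign i (Poly_Mapping.single (merge_at mul i (y # xs)) a)"
  have shift: "?f (Suc i) = - push ((#) x) (?g i)" if "i \<in> {1..length xs}" for i
  proof -
    have "merge_at mul (Suc i) (x # y # xs) = x # merge_at mul i (y # xs)"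
      using that by (cases i) (auto simp: merge_at_def)
    then show ?thesis by (simp add: alt_sign_def push_uminus)
  qed
  have "(\<Sum>i = 1..length (y # xs). ?f i) = ?f 1 + (\<Sum>i = 1..length xs. ?f (Suc i))"
    using sum.atLeast_Suc_atMost[of 1 "Suc (length xs)" ?f] sum.shift_bounds_cl_Suc_ivl[of ?f 1 "length xs"]
    by simp
  also have "(\<Sum>i = 1..length xs. ?f (Suc i)) = - push ((#) x) (\<Sum>i = 1..length xs. ?g i)"
    unfolding push_sum sum_negf[symmetric] by (rule sum.cong[OF refl shift])
  also have "(\<Sum>i = 1..length xs. ?g i) = - inner_faces mul (y # xs) a
      - alt_sign (Suc (length xs)) (Poly_Mapping.single (butlast (y # xs)) a)"
    using Cons.IH[of y] by (simp add: eq_diff_eq)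
  finally show ?case
    by (simp add: push_diff push_uminus push_alt_sign merge_at_def)
      (simp add: alt_sign_def)
qed

lemma bar_boundary_gen_eq:
  "bar_boundary_gen mul act a xs = first_face act xs a - inner_faces mul xs a"
proof (cases xs)
  case (Cons x ys)
  then show ?thesis
    using alternating_inner_faces[of mul x ys a]
    by (simp add: bar_boundary_gen_def add.assoc)
qed (simp add: bar_boundary_gen_def)

lemma additive_inner_faces: "additive_gen (inner_faces mul)"
proof (unfold additive_gen_def, intro allI)
  show "inner_faces mul xs (a + b) = inner_faces mul xs a + inner_faces mul xs b" for xs a b
    by (induction mul xs a rule: inner_faces.induct) (simp_all add: single_add push_add)
qed

definition additive_action :: "('a::ab_group_add \<Rightarrow> 'x \<Rightarrow> 'a) \<Rightarrow> bool" where
  "additive_action act \<longleftrightarrow> (\<forall>a b x. act (a + b) x = act a x + act b x)"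

lemma additive_first_face:
  assumes "additive_action act" shows "additive_gen (first_face act)"
proof -
  have "first_face act xs (a + b) = first_face act xs a + first_face act xs b" for xs a b
    using assms by (cases xs) (simp_all add: single_add additive_action_def)
  then show ?thesis by (simp add: additive_gen_def)
qed

lemma bar_boundary_eq_lin_ext:
  "bar_boundary mul act = lin_ext (\<lambda>xs a. first_face act xs a - inner_faces mul xs a)"
  by (rule ext) (simp add: bar_boundary_def lin_ext_def bar_boundary_gen_eq)

lemma bar_boundary_eq:
  "bar_boundary mul act c = lin_ext (first_face act) c - lin_ext (inner_faces mul) c"
  by (simp add: bar_boundary_eq_lin_ext lin_ext_def sum_subtractf)

lemma bar_boundary_zero [simp]: "bar_boundary mul act 0 = 0"
  by (simp add: bar_boundary_def)

lemma bar_boundary_add: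
  "additive_action act \<Longrightarrow> bar_boundary mul act (c + d) = bar_boundary mul act c + bar_boundary mul act d"
  by (simp add: bar_boundary_eq lin_ext_add additive_inner_faces additive_first_face)

lemma bar_boundary_diff:
  "additive_action act \<Longrightarrow> bar_boundary mul act (c - d) = bar_boundary mul act c - bar_boundary mul act d"
  by (simp add: bar_boundary_eq lin_ext_diff additive_inner_faces additive_first_face)

lemma bar_boundary_single:
  "additive_action act \<Longrightarrow> bar_boundary mul act (Poly_Mapping.single xs a)
     = first_face act xs a - inner_faces mul xs a"
  by (simp add: bar_boundary_eq lin_ext_single_additive additive_inner_faces additive_first_face)

text \<open>
  The action enters the boundary only through first entries. This makes it harmless to replace an
  action by one that agrees with it where it matters and is additive without exception.
\<close>

lemma bar_boundary_cong:
  assumes "\<And>x xs a. x # xs \<in> Poly_Mapping.keys c \<Longrightarrow> act a x = act' a x"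
  shows "bar_boundary mul act c = bar_boundary mul act' c"
proof -
  have "first_face act xs a = first_face act' xs a" if "xs \<in> Poly_Mapping.keys c" for xs a
    using that assms by (cases xs) simp_all
  then show ?thesis by (simp add: bar_boundary_eq_lin_ext lin_ext_def)
qed

lemma inner_faces_push:
  "successively (\<lambda>x y. f (mul x y) = mul' (f x) (f y)) xs
    \<Longrightarrow> inner_faces mul' (map f xs) a = push (map f) (inner_faces mul xs a)"
proof (induction mul xs a rule: inner_faces.induct)
  case (3 mul x y xs a)
  then show ?case by (simp add: push_diff push_push)
qed simp_all

text \<open>
  Naturality of the boundary. A map \<open>f\<close> needs to be multiplicative only on neighbouring entries of the
  tuples that occur, which is all that \<open>s \<mapsto> \<langle>s\<rangle>\<close> satisfies.
\<close>

lemma bar_boundary_push: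
  assumes "additive_action act" "additive_action act'"
    and "Poly_Mapping.keys c \<subseteq> K"
    and "\<And>xs. xs \<in> K \<Longrightarrow> successively (\<lambda>x y. f (mul x y) = mul' (f x) (f y)) xs"
    and "\<And>x xs a. x # xs \<in> K \<Longrightarrow> act' a (f x) = act a x"
  shows "bar_boundary mul' act' (push (map f) c) = push (map f) (bar_boundary mul act c)"
  using assms(3)
proof (induction rule: chain_induct)
  case (single xs a)
  then have "first_face act' (map f xs) a = push (map f) (first_face act xs a)"
    using assms(5) by (cases xs) simp_all
  then show ?case
    using assms(1,2) inner_faces_push[OF assms(4)[OF single]]
    by (simp add: bar_boundary_single push_diff)
qed (simp_all add: push_add bar_boundary_add assms)

section \<open>The boundary squares to zero\<close>

lemma lin_ext_inner_faces_Cons_Cons: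
  fixes c :: "'x list \<Rightarrow>\<^sub>0 'a::ab_group_add"
  shows "lin_ext (inner_faces mul) (push ((#) x) (push ((#) y) c))
     = push ((#) (mul x y)) c - push ((#) x) (lin_ext (inner_faces mul) (push ((#) y) c))"
proof (rule chain_induct[of c UNIV])
  show "lin_ext (inner_faces mul) (push ((#) x) (push ((#) y) (Poly_Mapping.single k a)))
     = push ((#) (mul x y)) (Poly_Mapping.single k a)
       - push ((#) x) (lin_ext (inner_faces mul) (push ((#) y) (Poly_Mapping.single k a)))" for k and a :: 'a
    by (simp add: lin_ext_single_additive additive_inner_faces)
qed (simp_all add: push_add lin_ext_add additive_inner_faces)

text \<open>
  Write \<open>D\<close> for the inner faces and \<open>x\<cdot>c\<close> for prefixing the tuples of \<open>c\<close> with \<open>x\<close>, so that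
  \<open>D(x\<cdot>y\<cdot>c) = (xy)\<cdot>c - x\<cdot>D(y\<cdot>c)\<close>. Expanding \<open>D(D[x, y, z, ...])\<close> with this rule, the terms beginning
  with \<open>xyz\<close> and with \<open>xy\<close> cancel, the former by associativity, and \<open>x\<cdot>D(D[y, z, ...])\<close> remains.
\<close>

lemma inner_faces_inner_faces:
  assumes "\<And>x y. x \<in> G \<Longrightarrow> y \<in> G \<Longrightarrow> mul x y \<in> G"
    and assoc: "\<And>x y z. \<lbrakk>x \<in> G; y \<in> G; z \<in> G\<rbrakk> \<Longrightarrow> mul (mul x y) z = mul x (mul y z)"
  shows "set xs \<subseteq> G \<Longrightarrow> lin_ext (inner_faces mul) (inner_faces mul xs a) = 0"
proof (induction "length xs" arbitrary: xs rule: less_induct)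
  case less
  note s = lin_ext_single_additive[OF additive_inner_faces[of mul]]
  consider "xs = []" | x where "xs = [x]" | x y where "xs = [x, y]" | x y z r where "xs = x # y # z # r"
    by (metis list.exhaust)
  then show ?case
  proof cases
    case (4 x y z r)
    have IH: "lin_ext (inner_faces mul) (inner_faces mul (y # z # r) a) = 0"
      using less(1)[of "y # z # r"] less(2) unfolding 4 by (simp del: inner_faces.simps)
    have "mul (mul x y) z = mul x (mul y z)" using less.prems assoc by (simp add: 4)
    then have "lin_ext (inner_faces mul) (inner_faces mul xs a)
       = push ((#) x) (lin_ext (inner_faces mul) (inner_faces mul (y # z # r) a))"
      by (simp add: 4 s lin_ext_diff additive_inner_faces push_diff lin_ext_inner_faces_Cons_Cons
          del: push_zero)
    with IH show ?thesis by simp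
  qed (simp_all add: s lin_ext_diff additive_inner_faces)
qed

lemma map_coeff_inner_faces:
  assumes "\<And>a b. h (a + b) = h a + h b"
  shows "map_coeff h (inner_faces mul xs a) = inner_faces mul xs (h a)"
proof -
  have add: "additive_gen (\<lambda>k::'x list. \<lambda>a. Poly_Mapping.single k (h a))"
    by (simp add: additive_gen_def assms single_add)
  have s: "map_coeff h (Poly_Mapping.single k a) = Poly_Mapping.single k (h a)" for k :: "'x list" and a
    unfolding map_coeff_def by (rule lin_ext_single_additive[OF add])
  have d: "map_coeff h (c - d) = map_coeff h c - map_coeff h d" for c d :: "'x list \<Rightarrow>\<^sub>0 _"
    by (simp add: map_coeff_def lin_ext_diff add)
  have p: "map_coeff h (push ((#) x) c) = push ((#) x) (map_coeff h c)" for x c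
    by (rule chain_induct[of c UNIV])
      (auto simp: s push_add map_coeff_def lin_ext_add[OF add] s[unfolded map_coeff_def])
  show ?thesis
    by (induction mul xs a rule: inner_faces.induct) (simp_all add: s d p, simp add: map_coeff_def)
qed

lemma first_face_push_Cons:
  fixes c :: "'x list \<Rightarrow>\<^sub>0 'a::ab_group_add"
  assumes "additive_action act"
  shows "lin_ext (first_face act) (push ((#) x) c) = map_coeff (\<lambda>a. act a x) c"
proof -
  have add: "additive_gen (\<lambda>k::'x list. \<lambda>a. Poly_Mapping.single k (act a x))"
    using assms by (simp add: additive_gen_def additive_action_def single_add)
  show ?thesis
    unfolding map_coeff_def
    by (rule chain_induct[of c UNIV])
      (auto simp: push_add lin_ext_add add additive_first_face assms
        lin_ext_single_additive[OF add]
        lin_ext_single_additive[OF additive_first_face[OF assms]])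
qed

text \<open>
  With \<open>F\<close> for the face that uses the action and \<open>D\<close> for the inner faces, the boundary is \<open>F - D\<close>, and
  its square vanishes because \<open>DD = 0\<close> and \<open>FF = FD + DF\<close>. In the latter, \<open>FF\<close> matches the merging of
  the first two entries, and all other terms of \<open>FD\<close> and \<open>DF\<close> cancel.
\<close>

lemma bar_boundary_bar_boundary:
  assumes act: "additive_action act"
    and closed: "\<And>x y. x \<in> G \<Longrightarrow> y \<in> G \<Longrightarrow> mul x y \<in> G"
    and assoc: "\<And>x y z. \<lbrakk>x \<in> G; y \<in> G; z \<in> G\<rbrakk> \<Longrightarrow> mul (mul x y) z = mul x (mul y z)"
    and act_act: "\<And>a x y. x \<in> G \<Longrightarrow> y \<in> G \<Longrightarrow> act (act a x) y = act a (mul x y)"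
    and "Poly_Mapping.keys c \<subseteq> {xs. set xs \<subseteq> G}"
  shows "bar_boundary mul act (bar_boundary mul act c) = 0"
  using assms(5)
proof (induction rule: chain_induct)
  case (single xs a)
  note s = lin_ext_single_additive[OF additive_inner_faces[of mul]]
    lin_ext_single_additive[OF additive_first_face[OF act]]
  have inner: "lin_ext (inner_faces mul) (inner_faces mul xs a) = 0"
    by (rule inner_faces_inner_faces[OF closed assoc]) (use single in auto)
  have mixed: "lin_ext (first_face act) (first_face act xs a)
    = lin_ext (first_face act) (inner_faces mul xs a) + lin_ext (inner_faces mul) (first_face act xs a)"
  proof -
    consider "xs = []" | x where "xs = [x]" | x y r where "xs = x # y # r" by (metis list.exhaust)
    then show ?thesis
    proof cases
      case (3 x y r)
      have "lin_ext (first_face act) (push ((#) x) (inner_faces mul (y # r) a)) = inner_faces mul (y # r) (act a x)"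
        using act unfolding first_face_push_Cons[OF act] additive_action_def
        by (intro map_coeff_inner_faces) auto
      then show ?thesis
        using 3 single act_act by (simp add: s lin_ext_diff additive_first_face act)
    qed (simp_all add: s)
  qed
  show ?case
    unfolding bar_boundary_single[OF act]
      bar_boundary_eq[of mul act "first_face act xs a - inner_faces mul xs a"]
    by (simp add: lin_ext_diff additive_inner_faces additive_first_face act inner mixed)
qed (simp_all add: act bar_boundary_add)

section \<open>The 0-reflector as a semigroup of words\<close>

locale categorical_zero_module = zero_module act
  for act :: "'a::ab_group_add \<Rightarrow> 's::{semigroup_mult,mult_zero} \<Rightarrow> 'a" +
  assumes categorical: "\<And>x y z :: 's. x * y * z = 0 \<Longrightarrow> x * y = 0 \<or> y * z = 0"
begin

lemma triple_zero_iff: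
  fixes x y z :: 's
  shows "x * y * z = 0 \<longleftrightarrow> x * y = 0 \<or> y * z = 0"
  using categorical[of x y z] mult_zero_assoc[of x y z] by (auto simp: mult.assoc)

text \<open>
  Either clause of \<open>nu\<close> would have to start from a product \<open>xyz = 0\<close> with \<open>xy\<close> and \<open>yz\<close> both nonzero:
  neighbours in a sequence multiply to zero, while its entries are nonzero.
\<close>

lemma no_nu: "\<not> nu (xs :: 's list) ys"
proof
  assume "nu xs ys"
  then show False
  proof cases
    case (shift as t u s bs)
    then have "t * u * s = 0" "t * u \<noteq> 0" "u * s \<noteq> 0"
      by (auto simp: zero_seqs_def successively_append_iff)
    then show False by (simp add: triple_zero_iff)
  next
    case (split as p u v q bs)
    then have "p * u * v = 0" "p * u \<noteq> 0" "u * v \<noteq> 0"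
      by (auto simp: zero_seqs_def successively_append_iff mult.assoc)
    then show False by (simp add: triple_zero_iff)
  qed
qed

lemma nu_rel_eq: "(xs :: 's list, ys) \<in> nu_rel \<longleftrightarrow> xs \<in> zero_seqs \<and> xs = ys"
proof
  assume "(xs, ys) \<in> nu_rel"
  then have "xs \<in> zero_seqs" "xs = ys"
    by (simp add: nu_rel_def, induction rule: nu_rel_induct) (auto simp: no_nu)
  then show "xs \<in> zero_seqs \<and> xs = ys" ..
qed (auto simp: nu_rel_refl)

lemma nu_class_eq: "w \<in> zero_seqs \<Longrightarrow> nu_class (w :: 's list) = {w}"
  by (auto simp: nu_class_def nu_rel_eq)

lemma seq_mult_associative:
  fixes u v w :: "'s list"
  assumes "u \<in> zero_seqs" "v \<in> zero_seqs" "w \<in> zero_seqs"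
  shows "seq_mult (seq_mult u v) w = seq_mult u (seq_mult v w)"
  using seq_mult_assoc[OF assms] by (simp add: nu_rel_eq)

text \<open>
  The action of a 0-module is arbitrary at \<open>0\<close>. Extending it by zero there makes the action of words
  additive in \<open>a\<close> without side conditions and changes nothing on sequences of nonzero letters.
\<close>

definition act0 :: "'a \<Rightarrow> 's \<Rightarrow> 'a" where
  "act0 a s = (if s = 0 then 0 else act a s)"

definition word_act :: "'a \<Rightarrow> 's list \<Rightarrow> 'a" where
  "word_act = foldl act0"

lemma additive_act0: "additive_action act0"
  by (simp add: additive_action_def act0_def act_add)

lemma additive_word_act: "additive_action word_act"
proof -
  have "foldl act0 (a + b) w = foldl act0 a w + foldl act0 b w" for a b w
    by (induction w arbitrary: a b) (use additive_act0 in \<open>simp_all add: additive_action_def\<close>)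
  then show ?thesis by (simp add: additive_action_def word_act_def)
qed

lemma word_act_eq: "0 \<notin> set w \<Longrightarrow> word_act a w = foldl act a w"
  unfolding word_act_def by (induction w arbitrary: a) (auto simp: act0_def)

lemma word_act_seq_mult:
  assumes "v \<in> zero_seqs" "w \<in> zero_seqs"
  shows "word_act (word_act a v) w = word_act a (seq_mult v w)"
proof -
  obtain v' x y w' where [simp]: "v = v' @ [x]" "w = y # w'"
    using assms by (cases v rule: rev_cases; cases w) (auto simp: zero_seqs_def)
  have "0 \<notin> set v" "0 \<notin> set w" "0 \<notin> set (seq_mult v w)"
    using assms seq_mult_closed[OF assms] by (auto simp: zero_seqs_def)
  moreover have "foldl act (foldl act a v) w = foldl act a (seq_mult v w)"
    by (simp add: seq_mult_Cons act_act)
  ultimately show ?thesis by (simp add: word_act_eq)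
qed

definition word_tuples :: "nat \<Rightarrow> 's list list set" where
  "word_tuples n = {ws. length ws = n \<and> set ws \<subseteq> zero_seqs}"

abbreviation word_boundary :: "('s list list \<Rightarrow>\<^sub>0 'a) \<Rightarrow> ('s list list \<Rightarrow>\<^sub>0 'a)" where
  "word_boundary \<equiv> bar_boundary seq_mult word_act"

lemmas word_boundary_add = bar_boundary_add[OF additive_word_act]
lemmas word_boundary_diff = bar_boundary_diff[OF additive_word_act]
lemmas word_boundary_single = bar_boundary_single[OF additive_word_act]

lemma word_boundary_word_boundary:
  assumes "Poly_Mapping.keys c \<subseteq> word_tuples n"
  shows "word_boundary (word_boundary c) = 0"
  by (rule bar_boundary_bar_boundary[where G = zero_seqs])
    (use assms in \<open>auto simp: additive_word_act seq_mult_closed seq_mult_associative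
        word_act_seq_mult word_tuples_def\<close>)

lemma keys_inner_faces_words:
  assumes "ws \<in> word_tuples (Suc n)"
  shows "Poly_Mapping.keys (inner_faces seq_mult ws a) \<subseteq> word_tuples n"
  using assms
proof (induction "seq_mult :: 's list \<Rightarrow> _" ws a arbitrary: n rule: inner_faces.induct)
  case (3 v w ws a)
  then obtain m where n: "n = Suc m" and "w # ws \<in> word_tuples (Suc m)"
    by (auto simp: word_tuples_def)
  then have "Poly_Mapping.keys (inner_faces seq_mult (w # ws) a) \<subseteq> word_tuples m"
    using "3.hyps" by blast
  then have "Poly_Mapping.keys (push ((#) v) (inner_faces seq_mult (w # ws) a)) \<subseteq> word_tuples n"
    using keys_push[of "(#) v" "inner_faces seq_mult (w # ws) a"] "3.prems"
    by (fastforce simp: n word_tuples_def)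
  moreover have "seq_mult v w # ws \<in> word_tuples n"
    using "3.prems" by (auto simp: word_tuples_def seq_mult_closed)
  ultimately show ?case
    using keys_diff[of "Poly_Mapping.single (seq_mult v w # ws) a" "push ((#) v) (inner_faces seq_mult (w # ws) a)"]
    by (auto split: if_splits)
qed (auto simp: word_tuples_def)

lemma keys_word_boundary:
  assumes "Poly_Mapping.keys c \<subseteq> word_tuples (Suc n)"
  shows "Poly_Mapping.keys (word_boundary c) \<subseteq> word_tuples n"
  using assms
proof (induction rule: chain_induct)
  case (single ws a)
  then have "Poly_Mapping.keys (first_face word_act ws a) \<subseteq> word_tuples n"
    by (cases ws) (auto simp: word_tuples_def)
  with keys_inner_faces_words[OF single] show ?case
    unfolding word_boundary_single
    using keys_diff[of "first_face word_act ws a" "inner_faces seq_mult ws a"] by blast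
next
  case (add c d)
  then show ?case unfolding word_boundary_add using keys_add[of "word_boundary c" "word_boundary d"] by blast
qed simp

section \<open>A perfect matching of the tuples outside the 0-complex\<close>

text \<open>
  The good tuples are those that come from tuples of the 0-complex: one-letter words whose neighbouring
  letters have nonzero products. Any other tuple has a first entry \<open>w\<close> that spoils this. It is
  called upper if the preceding entry is a letter \<open>x\<close> with \<open>x * hd w = 0\<close>, and lower otherwise, in which
  case \<open>w\<close> has at least two letters.

  In an upper tuple the product of \<open>x\<close> and \<open>w\<close> in the reflector is their concatenation, and \<open>collapse\<close>
  performs it; the result is lower. Conversely \<open>expand\<close> splits the spoiling word of a lower tuple
  after its first letter. The two operations are mutually inverse.
\<close>

primrec good :: "'s list list \<Rightarrow> bool" where
  "good [] \<longleftrightarrow> True"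
| "good (w # ws) \<longleftrightarrow> length w = 1 \<and> (ws = [] \<or> hd w * hd (hd ws) \<noteq> 0) \<and> good ws"

primrec upper :: "'s list list \<Rightarrow> bool" where
  "upper [] \<longleftrightarrow> False"
| "upper (w # ws) \<longleftrightarrow> length w = 1 \<and> ws \<noteq> [] \<and> (hd w * hd (hd ws) = 0 \<or> upper ws)"

primrec lower :: "'s list list \<Rightarrow> bool" where
  "lower [] \<longleftrightarrow> False"
| "lower (w # ws) \<longleftrightarrow> length w \<ge> 2 \<or> ws \<noteq> [] \<and> hd w * hd (hd ws) \<noteq> 0 \<and> lower ws"

primrec expand :: "'s list list \<Rightarrow> 's list list" where
  "expand [] = []"
| "expand (w # ws) = (if length w \<ge> 2 then [hd w] # tl w # ws else w # expand ws)"

fun collapse :: "'s list list \<Rightarrow> 's list list" where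
  "collapse (v # w # ws) = (if hd v * hd w = 0 then (v @ w) # ws else v # collapse (w # ws))"
| "collapse ws = ws"

text \<open>
  Collapsing and expanding preserve the number of letters, whereas dropping the first entry decreases
  it; this is the measure that makes the matching acyclic.
\<close>

definition letters :: "'s list list \<Rightarrow> nat" where
  "letters ws = length (concat ws)"

lemma zero_seqs_tl:
  assumes "w \<in> zero_seqs" "length w \<ge> 2"
  shows "[hd w] \<in> zero_seqs" "tl w \<in> zero_seqs" "hd w * hd (tl w) = 0" "[hd w] @ tl w = w"
  using assms by (cases w; cases "tl w"; auto simp: zero_seqs_def)+

lemma word_cases:
  assumes "w \<in> zero_seqs" obtains x where "w = [x]" "x \<noteq> 0" | "length w \<ge> 2"
  using assms by (cases w; cases "tl w"; auto simp: zero_seqs_def)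

lemma good_upper_lower:
  "ws \<in> word_tuples n \<Longrightarrow> good ws \<or> upper ws \<or> lower ws"
  by (induction ws arbitrary: n) (auto simp: word_tuples_def elim: word_cases)

lemma upper_not_lower: "upper ws \<Longrightarrow> \<not> lower ws"
  by (induction ws) auto

lemma good_not_lower: "good ws \<Longrightarrow> \<not> lower ws"
  by (induction ws) auto

lemma hd_hd_expand: "lower ws \<Longrightarrow> expand ws \<noteq> [] \<and> hd (hd (expand ws)) = hd (hd ws)"
  by (cases ws) auto

lemma expand_lower:
  assumes "lower ws" "ws \<in> word_tuples n"
  shows "upper (expand ws)" "collapse (expand ws) = ws" "expand ws \<in> word_tuples (Suc n)"
    "letters (expand ws) = letters ws"
proof -
  have "upper (expand ws) \<and> collapse (expand ws) = ws \<and> expand ws \<in> word_tuples (Suc n)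
    \<and> letters (expand ws) = letters ws"
    using assms
  proof (induction ws arbitrary: n)
    case (Cons w ws)
    have w: "w \<in> zero_seqs" using Cons.prems by (auto simp: word_tuples_def)
    show ?case
    proof (cases "length w \<ge> 2")
      case True
      then show ?thesis
        using Cons.prems zero_seqs_tl[OF w True] by (auto simp: word_tuples_def letters_def)
    next
      case False
      then obtain x where x: "w = [x]" using w by (auto elim: word_cases)
      obtain m where n: "n = Suc m" and ws: "ws \<in> word_tuples m" "lower ws" "x * hd (hd ws) \<noteq> 0"
        using Cons.prems x by (auto simp: word_tuples_def)
      obtain v vs where v: "expand ws = v # vs" using hd_hd_expand[OF ws(2)] by (cases "expand ws") auto
      then have "hd v = hd (hd ws)" using hd_hd_expand[OF ws(2)] by simp
      then show ?thesis
        using Cons.IH[OF ws(2,1)] ws w x v by (auto simp: n word_tuples_def letters_def)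
    qed
  qed simp
  then show "upper (expand ws)" "collapse (expand ws) = ws" "expand ws \<in> word_tuples (Suc n)"
    "letters (expand ws) = letters ws" by auto
qed

lemma collapse_upper:
  assumes "upper ws" "ws \<in> word_tuples n"
  shows "lower (collapse ws)" "expand (collapse ws) = ws" "letters (collapse ws) = letters ws"
proof -
  have "lower (collapse ws) \<and> expand (collapse ws) = ws \<and> letters (collapse ws) = letters ws
      \<and> collapse ws \<noteq> [] \<and> hd (hd (collapse ws)) = hd (hd ws)"
    using assms
  proof (induction ws arbitrary: n rule: collapse.induct)
    case (1 v w ws)
    then obtain x where v: "v = [x]" by (auto simp: length_Suc_conv)
    have w: "w \<noteq> []" using "1.prems" by (auto simp: word_tuples_def zero_seqs_def)
    show ?case
    proof (cases "x * hd w = 0")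
      case True
      then show ?thesis using v w by (cases w) (auto simp: letters_def)
    next
      case False
      then have "lower (collapse (w # ws)) \<and> expand (collapse (w # ws)) = w # ws
          \<and> letters (collapse (w # ws)) = letters (w # ws)
          \<and> collapse (w # ws) \<noteq> [] \<and> hd (hd (collapse (w # ws))) = hd w"
        using "1.IH"[of "length (w # ws)"] "1.prems" v by (auto simp: word_tuples_def)
      then show ?thesis using False v by (auto simp: letters_def)
    qed
  qed auto
  then show "lower (collapse ws)" "expand (collapse ws) = ws" "letters (collapse ws) = letters ws"
    by auto
qed

lemma collapse_inj:
  assumes "upper u" "upper v" "u \<in> word_tuples n" "v \<in> word_tuples n" "collapse u = collapse v"
  shows "u = v"
proof -
  have "u = expand (collapse u)" by (rule collapse_upper(2)[OF assms(1,3), symmetric])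
  also have "\<dots> = v" unfolding assms(5) by (rule collapse_upper(2)[OF assms(2,4)])
  finally show ?thesis .
qed

lemma letters_tl: "ws \<in> word_tuples n \<Longrightarrow> ws \<noteq> [] \<Longrightarrow> letters (tl ws) < letters ws"
  by (cases ws) (auto simp: letters_def word_tuples_def zero_seqs_def)

section \<open>Faces of good and of upper tuples\<close>

lemma keys_inner_faces_Cons_Cons:
  assumes "k \<in> Poly_Mapping.keys (inner_faces mul (v # w # ws) a)"
  shows "k = mul v w # ws \<or> (\<exists>k'\<in>Poly_Mapping.keys (inner_faces mul (w # ws) a). k = v # k')"
proof -
  have "k \<in> Poly_Mapping.keys (Poly_Mapping.single (mul v w # ws) a)
      \<union> Poly_Mapping.keys (push ((#) v) (inner_faces mul (w # ws) a))"
    using assms keys_diff[of "Poly_Mapping.single (mul v w # ws) a" "push ((#) v) (inner_faces mul (w # ws) a)"]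
    by auto
  then show ?thesis
    using keys_push[of "(#) v" "inner_faces mul (w # ws) a"] by (auto split: if_splits)
qed

text \<open>
  An inner face changes the first letter of a tuple at most by multiplying it from the right. Whether a
  letter put in front has a zero product with it is therefore the same before and after, which is what
  the next two lemmas record; for nonzero products this takes categoricity.
\<close>

lemma hd_hd_inner_faces:
  assumes "k \<in> Poly_Mapping.keys (inner_faces seq_mult (w # ws) a)" "set (w # ws) \<subseteq> zero_seqs" "k \<noteq> []"
  shows "\<exists>t. hd (hd k) = hd w \<or> hd (hd k) = hd w * t"
proof (cases ws)
  case Nil
  then show ?thesis using assms by (auto split: if_splits)
next
  case (Cons v vs)
  then have "k = seq_mult w v # vs \<or> (\<exists>k'. k = w # k')"
    using keys_inner_faces_Cons_Cons[OF assms(1)[unfolded Cons]] by auto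
  moreover have "hd (seq_mult w v) = hd w \<or> hd (seq_mult w v) = hd w * hd v"
    using assms(2) by (cases w; cases "tl w") (auto simp: seq_mult_def zero_seqs_def)
  ultimately show ?thesis by auto
qed

lemma mult_hd_face_nonzero:
  assumes "k \<in> Poly_Mapping.keys (inner_faces seq_mult (w # ws) a)" "w # ws \<in> word_tuples (Suc n)" "k \<noteq> []"
    and "x * hd w \<noteq> 0"
  shows "x * hd (hd k) \<noteq> 0"
proof -
  have "k \<in> word_tuples n" using keys_inner_faces_words[OF assms(2)] assms(1) by blast
  then have "hd (hd k) \<noteq> 0" using assms(3) by (cases k; cases "hd k") (auto simp: word_tuples_def zero_seqs_def)
  moreover obtain t where "hd (hd k) = hd w \<or> hd (hd k) = hd w * t"
    using hd_hd_inner_faces[OF assms(1) _ assms(3)] assms(2) by (auto simp: word_tuples_def)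
  ultimately show ?thesis
  proof (elim disjE)
    assume t: "hd (hd k) = hd w * t" and "hd (hd k) \<noteq> 0"
    then show ?thesis
      using assms(4) triple_zero_iff[of x "hd w" t] by (simp add: mult.assoc)
  qed (use assms(4) in simp)
qed

lemma mult_hd_face_zero:
  assumes "k \<in> Poly_Mapping.keys (inner_faces seq_mult (w # ws) a)" "w # ws \<in> word_tuples n" "k \<noteq> []"
    and "x * hd w = 0"
  shows "x * hd (hd k) = 0"
  using hd_hd_inner_faces[OF assms(1) _ assms(3)] assms(2,4)
  by (auto simp: word_tuples_def mult_zero_assoc)

lemma good_tl: "good ws \<Longrightarrow> good (tl ws)"
  by (cases ws) auto

lemma good_inner_faces:
  assumes "good ws" "ws \<in> word_tuples n" "k \<in> Poly_Mapping.keys (inner_faces seq_mult ws a)"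
  shows "good k"
  using assms
proof (induction ws arbitrary: k n)
  case (Cons v ws)
  show ?case
  proof (cases ws)
    case Nil
    then show ?thesis using Cons.prems by (auto split: if_splits)
  next
    case (Cons w us)
    obtain m where t: "w # us \<in> word_tuples (Suc m)" using Cons.prems(2) by (auto simp: Cons word_tuples_def)
    have g: "good (w # us)" using Cons.prems(1) by (simp add: Cons)
    obtain x y where x: "v = [x]" "w = [y]" "x * y \<noteq> 0"
      using Cons.prems(1) by (auto simp: Cons length_Suc_conv)
    consider "k = seq_mult v w # us"
      | k' where "k' \<in> Poly_Mapping.keys (inner_faces seq_mult (w # us) a)" "k = v # k'"
      using keys_inner_faces_Cons_Cons[OF Cons.prems(3)[unfolded Cons]] by auto
    then show ?thesis
    proof cases
      case 1
      then show ?thesis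
        using x g by (auto simp: seq_mult_def triple_zero_iff)
    next
      case 2
      then show ?thesis
        using Cons.IH[of "Suc m" k'] g t x mult_hd_face_nonzero[OF 2(1) t, of x] unfolding Cons by auto
    qed
  qed
qed simp

lemma upper_merge:
  assumes "upper ([y] # ws)" "x * y \<noteq> 0"
  shows "upper ([x * y] # ws)"
  using assms by (auto simp: triple_zero_iff)

text \<open>
  The matching is a matching in the bar complex: among the inner faces of an upper tuple, its collapse
  is the only lower one, and it occurs with coefficient \<open>1\<close> or \<open>-1\<close>. Merging letters before the
  spoiling product leaves this product zero, since the last letter of the merged word still annihilates;
  merging or dropping after it changes only what follows \<open>hd w\<close> from the right. If the product is in the
  last position, dropping the last entry makes the tuple good.
\<close>

lemma upper_inner_faces:
  assumes "upper ws" "ws \<in> word_tuples n"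
  shows "\<exists>b r. (b = a \<or> b = - a) \<and> inner_faces seq_mult ws a = Poly_Mapping.single (collapse ws) b + r
    \<and> (\<forall>k\<in>Poly_Mapping.keys r. good k \<or> upper k)"
  using assms
proof (induction ws arbitrary: n)
  case (Cons v ws)
  then obtain w us where ws: "ws = w # us" by (cases ws) auto
  obtain m where t: "w # us \<in> word_tuples (Suc m)" using Cons.prems(2) by (auto simp: ws word_tuples_def)
  obtain x where x: "v = [x]" using Cons.prems(1) by (auto simp: ws length_Suc_conv)
  show ?case
  proof (cases "x * hd w = 0")
    case True
    let ?p = "push ((#) v) (inner_faces seq_mult (w # us) a)"
    have "good k \<or> upper k" if k: "k \<in> Poly_Mapping.keys (- ?p)" for k
    proof -
      obtain k' where k': "k' \<in> Poly_Mapping.keys (inner_faces seq_mult (w # us) a)" "k = v # k'"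
        using k keys_push[of "(#) v" "inner_faces seq_mult (w # us) a"] by auto
      then show ?thesis using x mult_hd_face_zero[OF k'(1) t _ True] by (cases "k' = []") auto
    qed
    moreover have "inner_faces seq_mult (v # ws) a = Poly_Mapping.single (collapse (v # ws)) a + - ?p"
      using True x by (simp add: ws seq_mult_def)
    ultimately show ?thesis by blast
  next
    case False
    then have up: "upper (w # us)" using Cons.prems(1) by (simp add: ws x)
    then obtain y where y: "w = [y]" by (auto simp: length_Suc_conv)
    obtain b r where b: "b = a \<or> b = - a"
      and r: "inner_faces seq_mult (w # us) a = Poly_Mapping.single (collapse (w # us)) b + r"
        "\<forall>k\<in>Poly_Mapping.keys r. good k \<or> upper k"
      using Cons.IH[of "Suc m"] up t unfolding ws by blast
    define r' where "r' = Poly_Mapping.single (seq_mult v w # us) a - push ((#) v) r"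
    have "inner_faces seq_mult (v # ws) a = Poly_Mapping.single (collapse (v # ws)) (- b) + r'"
      using False r(1) by (simp add: ws x r'_def push_add single_uminus)
    moreover have "good k \<or> upper k" if k: "k \<in> Poly_Mapping.keys r'" for k
    proof -
      consider "k = seq_mult v w # us" | k' where "k' \<in> Poly_Mapping.keys r" "k = v # k'"
        using k keys_diff[of "Poly_Mapping.single (seq_mult v w # us) a" "push ((#) v) r"]
          keys_push[of "(#) v" r] unfolding r'_def by (fastforce split: if_splits)
      then show ?thesis
      proof cases
        case 1
        then show ?thesis using upper_merge[of y us x] up False by (simp add: x y seq_mult_def)
      next
        case 2
        have "k' \<noteq> collapse (w # us)"
          using r(2) 2(1) collapse_upper(1)[OF up t] good_not_lower upper_not_lower by blast
        then have "k' \<in> Poly_Mapping.keys (inner_faces seq_mult (w # us) a)"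
          using 2(1) unfolding r(1) by (simp add: in_keys_iff lookup_add lookup_single_not_eq)
        then have "k' \<noteq> [] \<Longrightarrow> x * hd (hd k') \<noteq> 0"
          using mult_hd_face_nonzero[OF _ t _ False] by blast
        then show ?thesis using r(2) 2 x by (cases "k' = []") auto
      qed
    qed
    ultimately show ?thesis using b by (intro exI[of _ "- b"] exI[of _ r']) auto
  qed
qed simp

section \<open>Acyclicity relative to the good tuples\<close>

text \<open>
  The boundary of \<open>a[u]\<close>, where \<open>u\<close> is the expansion of a lower tuple \<open>ws\<close>, replaces \<open>a[ws]\<close> by good and
  upper tuples and by one tuple with fewer letters, to which the induction hypothesis applies.
\<close>

lemma reduce_tuple:
  assumes "ws \<in> word_tuples n"
  shows "\<exists>d. Poly_Mapping.keys d \<subseteq> word_tuples (Suc n)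
     \<and> Poly_Mapping.keys (Poly_Mapping.single ws a - word_boundary d) \<subseteq> {k \<in> word_tuples n. good k \<or> upper k}"
  using assms
proof (induction "letters ws" arbitrary: ws a rule: less_induct)
  case less
  show ?case
  proof (cases "lower ws")
    case False
    then show ?thesis using good_upper_lower[OF less.prems] less.prems by (intro exI[of _ 0]) auto
  next
    case True
    let ?K = "{k \<in> word_tuples n. good k \<or> upper k}"
    define u where "u = expand ws"
    note u = expand_lower[OF True less.prems, folded u_def]
    obtain v vs where v: "u = v # vs" using u(1) by (cases u) auto
    obtain b r where b: "b = a \<or> b = - a"
      and r: "inner_faces seq_mult u a = Poly_Mapping.single ws b + r"
        "\<forall>k\<in>Poly_Mapping.keys r. good k \<or> upper k"
      using upper_inner_faces[OF u(1,3)] u(2) by metis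
    have bd: "word_boundary (Poly_Mapping.single u a)
        = Poly_Mapping.single vs (word_act a v) - Poly_Mapping.single ws b - r"
      unfolding word_boundary_single r(1) by (simp add: v)
    have "Poly_Mapping.keys r \<subseteq> ?K"
    proof
      fix k assume k: "k \<in> Poly_Mapping.keys r"
      then have "k \<noteq> ws" using r(2) True good_not_lower upper_not_lower by blast
      then have "k \<in> Poly_Mapping.keys (inner_faces seq_mult u a)"
        using k unfolding r(1) by (simp add: in_keys_iff lookup_add lookup_single_not_eq)
      then show "k \<in> ?K" using keys_inner_faces_words[OF u(3)] r(2) k by blast
    qed
    moreover have "letters vs < letters ws" "vs \<in> word_tuples n"
      using letters_tl[OF u(3)] u(3,4) by (auto simp: v word_tuples_def)
    then have IH: "\<exists>d. Poly_Mapping.keys d \<subseteq> word_tuples (Suc n)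
         \<and> Poly_Mapping.keys (Poly_Mapping.single vs e - word_boundary d) \<subseteq> ?K" for e
      using less.hyps by blast
    show ?thesis
    proof (cases "b = a")
      case True
      obtain d where d: "Poly_Mapping.keys d \<subseteq> word_tuples (Suc n)"
          "Poly_Mapping.keys (Poly_Mapping.single vs (word_act a v) - word_boundary d) \<subseteq> ?K"
        using IH by blast
      have "Poly_Mapping.single ws a - word_boundary (d - Poly_Mapping.single u a)
          = (Poly_Mapping.single vs (word_act a v) - word_boundary d) - r"
        by (simp add: word_boundary_diff bd True)
      then have "Poly_Mapping.keys (Poly_Mapping.single ws a - word_boundary (d - Poly_Mapping.single u a)) \<subseteq> ?K"
        using d(2) \<open>Poly_Mapping.keys r \<subseteq> ?K\<close>
          keys_diff[of "Poly_Mapping.single vs (word_act a v) - word_boundary d" r] by auto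
      moreover have "Poly_Mapping.keys (d - Poly_Mapping.single u a) \<subseteq> word_tuples (Suc n)"
        using keys_diff[of d "Poly_Mapping.single u a"] d(1) u(3) by (auto split: if_splits)
      ultimately show ?thesis by blast
    next
      case False
      obtain d where d: "Poly_Mapping.keys d \<subseteq> word_tuples (Suc n)"
          "Poly_Mapping.keys (Poly_Mapping.single vs (- word_act a v) - word_boundary d) \<subseteq> ?K"
        using IH by blast
      have "Poly_Mapping.single ws a - word_boundary (d + Poly_Mapping.single u a)
          = (Poly_Mapping.single vs (- word_act a v) - word_boundary d) + r"
        using False b by (simp add: word_boundary_add bd single_uminus)
      then have "Poly_Mapping.keys (Poly_Mapping.single ws a - word_boundary (d + Poly_Mapping.single u a)) \<subseteq> ?K"
        using d(2) \<open>Poly_Mapping.keys r \<subseteq> ?K\<close>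
          keys_add[of "Poly_Mapping.single vs (- word_act a v) - word_boundary d" r] by auto
      moreover have "Poly_Mapping.keys (d + Poly_Mapping.single u a) \<subseteq> word_tuples (Suc n)"
        using keys_add[of d "Poly_Mapping.single u a"] d(1) u(3) by (auto split: if_splits)
      ultimately show ?thesis by blast
    qed
  qed
qed

lemma reduce_chain:
  assumes "Poly_Mapping.keys c \<subseteq> word_tuples n"
  shows "\<exists>d. Poly_Mapping.keys d \<subseteq> word_tuples (Suc n)
     \<and> Poly_Mapping.keys (c - word_boundary d) \<subseteq> {k \<in> word_tuples n. good k \<or> upper k}"
  using assms
proof (induction rule: chain_induct)
  case zero
  show ?case by (intro exI[of _ 0]) simp
next
  case (single ws a)
  then show ?case by (rule reduce_tuple)
next
  case (add c c')
  then obtain d d' where d: "Poly_Mapping.keys d \<subseteq> word_tuples (Suc n)" "Poly_Mapping.keys d' \<subseteq> word_tuples (Suc n)"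
    "Poly_Mapping.keys (c - word_boundary d) \<subseteq> {k \<in> word_tuples n. good k \<or> upper k}"
    "Poly_Mapping.keys (c' - word_boundary d') \<subseteq> {k \<in> word_tuples n. good k \<or> upper k}"
    by blast
  have eq: "c + c' - word_boundary (d + d') = (c - word_boundary d) + (c' - word_boundary d')"
    by (simp add: word_boundary_add)
  show ?case
  proof (intro exI conjI)
    show "Poly_Mapping.keys (d + d') \<subseteq> word_tuples (Suc n)"
      using d(1,2) keys_add[of d d'] by blast
    show "Poly_Mapping.keys (c + c' - word_boundary (d + d')) \<subseteq> {k \<in> word_tuples n. good k \<or> upper k}"
      unfolding eq using d(3,4) keys_add[of "c - word_boundary d" "c' - word_boundary d'"] by blast
  qed
qed

text \<open>
  Take an upper tuple \<open>u\<close> of the chain with the largest number of letters. Its collapse is lower, and it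
  can arise in the boundary only from \<open>u\<close> itself: faces of good tuples are good, an inner face of an
  upper tuple that is lower determines the tuple, and as a face without the first entry it would come
  from an upper tuple with more letters. So it survives in the boundary,
  with coefficient plus or minus that of \<open>u\<close>.
\<close>

lemma upper_free:
  assumes c: "Poly_Mapping.keys c \<subseteq> {k \<in> word_tuples n. good k \<or> upper k}"
    and bd: "\<And>k. k \<in> Poly_Mapping.keys (word_boundary c) \<Longrightarrow> good k"
    and v: "v \<in> Poly_Mapping.keys c"
  shows "good v"
proof (rule ccontr)
  assume "\<not> good v"
  let ?U = "{k \<in> Poly_Mapping.keys c. upper k}"
  have "finite ?U" "v \<in> ?U" using c v \<open>\<not> good v\<close> by auto
  then obtain u where u: "u \<in> ?U" and max: "\<And>k. k \<in> ?U \<Longrightarrow> letters k \<le> letters u"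
    using Max_in[of "letters ` ?U"] Max_ge[of "letters ` ?U"] by fastforce
  then have uu: "u \<in> word_tuples n" "upper u" using c by auto
  note cu = collapse_upper[OF uu(2,1)]
  let ?f = "\<lambda>k. Poly_Mapping.lookup (first_face word_act k (Poly_Mapping.lookup c k)) (collapse u)"
  let ?g = "\<lambda>k. Poly_Mapping.lookup (inner_faces seq_mult k (Poly_Mapping.lookup c k)) (collapse u)"
  have f: "?f k = 0" if "k \<in> Poly_Mapping.keys c" for k
  proof (rule ccontr)
    assume "?f k \<noteq> 0"
    then have k: "k \<noteq> []" "tl k = collapse u" by (cases k; auto simp: lookup_single when_def split: if_splits)+
    with that c have "good k \<or> upper k" by auto
    then show False
    proof
      assume "good k"
      then show False using good_tl[of k] k cu(1) good_not_lower by auto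
    next
      assume "upper k"
      then have "letters k \<le> letters u" using max that by auto
      moreover have "letters (tl k) < letters k" using letters_tl[of k n] that c k(1) by auto
      ultimately show False using k(2) cu(3) by simp
    qed
  qed
  have r0: "Poly_Mapping.lookup r (collapse u) = 0" if "\<forall>k\<in>Poly_Mapping.keys r. good k \<or> upper k"
    for r :: "'s list list \<Rightarrow>\<^sub>0 'a"
  proof (rule ccontr)
    assume "Poly_Mapping.lookup r (collapse u) \<noteq> 0"
    then have "good (collapse u) \<or> upper (collapse u)" using that by (simp add: in_keys_iff)
    then show False using cu(1) good_not_lower upper_not_lower by blast
  qed
  have g: "?g k = 0" if k: "k \<in> Poly_Mapping.keys c" "k \<noteq> u" for k
  proof (cases "upper k")
    case True
    have kw: "k \<in> word_tuples n" using k c by auto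
    obtain b r where "inner_faces seq_mult k (Poly_Mapping.lookup c k) = Poly_Mapping.single (collapse k) b + r"
      "\<forall>k\<in>Poly_Mapping.keys r. good k \<or> upper k"
      using upper_inner_faces[OF True kw] by blast
    moreover have "collapse k \<noteq> collapse u" using collapse_inj[OF True uu(2) kw uu(1)] k(2) by auto
    ultimately show ?thesis using r0 by (simp add: lookup_add lookup_single_not_eq)
  next
    case False
    then have "good k" "k \<in> word_tuples n" using k c by auto
    then show ?thesis using good_inner_faces r0 by blast
  qed
  obtain b r where b: "b = Poly_Mapping.lookup c u \<or> b = - Poly_Mapping.lookup c u"
    and r: "inner_faces seq_mult u (Poly_Mapping.lookup c u) = Poly_Mapping.single (collapse u) b + r"
      "\<forall>k\<in>Poly_Mapping.keys r. good k \<or> upper k"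
    using upper_inner_faces[OF uu(2,1)] by blast
  have "Poly_Mapping.lookup (word_boundary c) (collapse u) = (\<Sum>k\<in>Poly_Mapping.keys c. ?f k - ?g k)"
    by (simp add: bar_boundary_eq_lin_ext lin_ext_def lookup_sum lookup_minus)
  also have "\<dots> = (\<Sum>k\<in>Poly_Mapping.keys c. if k = u then - ?g u else 0)"
  proof (rule sum.cong[OF refl])
    fix k assume "k \<in> Poly_Mapping.keys c"
    then show "?f k - ?g k = (if k = u then - ?g u else 0)" using f[of k] g[of k] by (cases "k = u") simp_all
  qed
  also have "\<dots> = - ?g u" using u by (simp add: sum.delta)
  also have "?g u = b" using r r0 by (simp add: lookup_add)
  finally have "Poly_Mapping.lookup (word_boundary c) (collapse u) = - b" .
  moreover have "b \<noteq> 0" using b u by (auto simp: in_keys_iff)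
  ultimately have "good (collapse u)" by (intro bd) (simp add: in_keys_iff)
  from good_not_lower[OF this] cu(1) show False by (rule notE)
qed

text \<open>
  In other words, the quotient of the complex of words by the subcomplex of good chains is acyclic.
\<close>

lemma relative_acyclicity:
  assumes c: "Poly_Mapping.keys c \<subseteq> word_tuples n"
    and bd: "\<And>k. k \<in> Poly_Mapping.keys (word_boundary c) \<Longrightarrow> good k"
  shows "\<exists>d. Poly_Mapping.keys d \<subseteq> word_tuples (Suc n)
     \<and> Poly_Mapping.keys (c - word_boundary d) \<subseteq> {k \<in> word_tuples n. good k}"
proof -
  obtain d where d: "Poly_Mapping.keys d \<subseteq> word_tuples (Suc n)"
    "Poly_Mapping.keys (c - word_boundary d) \<subseteq> {k \<in> word_tuples n. good k \<or> upper k}"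
    using reduce_chain[OF c] by blast
  have "word_boundary (c - word_boundary d) = word_boundary c"
    by (simp add: word_boundary_diff word_boundary_word_boundary[OF d(1)])
  then have bd': "good k" if "k \<in> Poly_Mapping.keys (word_boundary (c - word_boundary d))" for k
    using bd that by simp
  have "good k" if "k \<in> Poly_Mapping.keys (c - word_boundary d)" for k
    by (rule upper_free[OF d(2) bd' that])
  with d show ?thesis by blast
qed

section \<open>Comparison of the three complexes\<close>

definition letter_words :: "('s list \<Rightarrow>\<^sub>0 'a) \<Rightarrow> ('s list list \<Rightarrow>\<^sub>0 'a)" where
  "letter_words = push (map (\<lambda>s. [s]))"

definition word_classes :: "('s list list \<Rightarrow>\<^sub>0 'a) \<Rightarrow> ('s list set list \<Rightarrow>\<^sub>0 'a)" where
  "word_classes = push (map nu_class)"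

abbreviation zero_boundary :: "('s list \<Rightarrow>\<^sub>0 'a) \<Rightarrow> ('s list \<Rightarrow>\<^sub>0 'a)" where
  "zero_boundary \<equiv> bar_boundary (*) act"

abbreviation reflector_boundary :: "('s list set list \<Rightarrow>\<^sub>0 'a) \<Rightarrow> ('s list set list \<Rightarrow>\<^sub>0 'a)" where
  "reflector_boundary \<equiv> bar_boundary reflector_mult (reflector_act act)"

lemma eps_eq: "eps c = word_classes (letter_words c)"
  unfolding word_classes_def letter_words_def push_push
  by (simp add: eps_def push_def lin_ext_def comp_def)

lemma foldl_mult_nonzero_iff:
  "foldl (*) x xs \<noteq> 0 \<longleftrightarrow> 0 \<notin> set (x # xs) \<and> good (map (\<lambda>s. [s]) (x # xs))" for x :: 's
proof (induction xs arbitrary: x)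
  case (Cons y ys)
  have "foldl (*) x (y # ys) \<noteq> 0 \<longleftrightarrow> 0 \<notin> set ((x * y) # ys) \<and> good (map (\<lambda>s. [s]) ((x * y) # ys))"
    using Cons.IH[of "x * y"] by simp
  also have "\<dots> \<longleftrightarrow> 0 \<notin> set (x # y # ys) \<and> good (map (\<lambda>s. [s]) (x # y # ys))"
    by (cases ys) (auto simp: triple_zero_iff)
  finally show ?case .
qed auto

text \<open>
  By categoricity a product of several factors is nonzero as soon as the products of neighbouring
  factors are. This identifies the 0-complex with the good part of the complex of words.
\<close>

lemma nonzero_tuples_iff:
  "xs \<in> nonzero_tuples n \<longleftrightarrow> map (\<lambda>s. [s]) xs \<in> word_tuples n \<and> good (map (\<lambda>s. [s]) (xs :: 's list))"
proof (cases xs)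
  case (Cons x ys)
  have "(\<lambda>s. [s]) ` set xs \<subseteq> zero_seqs \<longleftrightarrow> 0 \<notin> set xs" by (auto simp: zero_seqs_def)
  then show ?thesis
    using foldl_mult_nonzero_iff[of x ys] Cons by (auto simp: nonzero_tuples_def word_tuples_def)
qed (auto simp: nonzero_tuples_def word_tuples_def)

lemma good_map_hd: "good ws \<Longrightarrow> map (\<lambda>s. [s]) (map hd ws) = ws"
  by (induction ws) (auto simp: length_Suc_conv)

lemma letter_words_left_inverse: "push (map hd) (letter_words c) = c"
  unfolding letter_words_def by (rule push_left_inverse) (simp add: comp_def)

lemma letter_words_inject: "letter_words c = letter_words d \<longleftrightarrow> c = d"
  using letter_words_left_inverse by metis

lemma letter_words_simps:
  "letter_words 0 = 0" "letter_words (c + d) = letter_words c + letter_words d"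
  by (simp_all add: letter_words_def push_add)

lemma keys_letter_words:
  assumes "Poly_Mapping.keys c \<subseteq> nonzero_tuples n"
  shows "Poly_Mapping.keys (letter_words c) \<subseteq> {ws \<in> word_tuples n. good ws}"
proof -
  have "map (\<lambda>s. [s]) ` nonzero_tuples n \<subseteq> {ws \<in> word_tuples n. good ws}"
    using nonzero_tuples_iff by blast
  then show ?thesis
    using assms keys_push[of "map (\<lambda>s. [s])" c] unfolding letter_words_def by blast
qed

lemma good_chain_letter_words:
  assumes "Poly_Mapping.keys c \<subseteq> {ws \<in> word_tuples n. good ws}"
  obtains z where "Poly_Mapping.keys z \<subseteq> nonzero_tuples n" "c = letter_words z"
proof
  have "map hd ws \<in> nonzero_tuples n" if "ws \<in> word_tuples n" "good ws" for ws
    using that good_map_hd[OF that(2)] by (simp only: nonzero_tuples_iff)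
  then show "Poly_Mapping.keys (push (map hd) c) \<subseteq> nonzero_tuples n"
    using assms keys_push[of "map hd" c] by blast
  show "c = letter_words (push (map hd) c)"
    unfolding letter_words_def
    by (rule push_left_inverse[symmetric]) (use assms good_map_hd in blast)
qed

lemma keys_word_boundary_good:
  assumes "Poly_Mapping.keys c \<subseteq> {ws \<in> word_tuples n. good ws}"
  shows "Poly_Mapping.keys (word_boundary c) \<subseteq> {ws. good ws}"
  using assms
proof (induction rule: chain_induct)
  case (single ws a)
  have "good (tl ws)" using single good_tl by blast
  then have "Poly_Mapping.keys (first_face word_act ws a) \<subseteq> {ws. good ws}"
    by (cases ws) auto
  moreover have "Poly_Mapping.keys (inner_faces seq_mult ws a) \<subseteq> {ws. good ws}"
    using single good_inner_faces by blast
  ultimately show ?case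
    unfolding word_boundary_single
    using keys_diff[of "first_face word_act ws a" "inner_faces seq_mult ws a"] by blast
next
  case (add c d)
  then show ?case
    unfolding word_boundary_add using keys_add[of "word_boundary c" "word_boundary d"] by blast
qed simp

lemma zero_boundary_act0:
  assumes "Poly_Mapping.keys c \<subseteq> nonzero_tuples n"
  shows "zero_boundary c = bar_boundary (*) act0 c"
proof (rule bar_boundary_cong)
  fix x xs a assume "x # xs \<in> Poly_Mapping.keys c"
  then have "x # xs \<in> nonzero_tuples n" using assms by blast
  then have "x \<noteq> 0" unfolding nonzero_tuples_iff by (simp add: word_tuples_def zero_seqs_def)
  then show "act a x = act0 a x" by (simp add: act0_def)
qed

lemma letter_words_boundary:
  assumes "Poly_Mapping.keys c \<subseteq> nonzero_tuples n"
  shows "word_boundary (letter_words c) = letter_words (zero_boundary c)"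
  unfolding zero_boundary_act0[OF assms] letter_words_def
proof (rule bar_boundary_push[OF additive_act0 additive_word_act assms])
  fix xs :: "'s list" assume "xs \<in> nonzero_tuples n"
  then have "good (map (\<lambda>s. [s]) xs)" by (simp add: nonzero_tuples_iff)
  then show "successively (\<lambda>x y. [x * y] = seq_mult [x] [y]) xs"
    by (induction xs rule: induct_list012) (auto simp: seq_mult_def)
next
  show "word_act a [x] = act0 a x" for a x by (simp add: word_act_def)
qed

lemma zero_boundary_diff:
  assumes "c \<in> bar_chains nonzero_tuples n" "d \<in> bar_chains nonzero_tuples n"
  shows "zero_boundary (c - d) = zero_boundary c - zero_boundary d"
proof -
  have "Poly_Mapping.keys (c - d) \<subseteq> nonzero_tuples n" using keys_diff[of c d] assms unfolding bar_chains_def by blast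
  then show "zero_boundary (c - d) = zero_boundary c - zero_boundary d"
    using zero_boundary_act0 assms by (simp add: bar_chains_def bar_boundary_diff[OF additive_act0])
qed

text \<open>
  Like \<open>\<partial>\<partial> = 0\<close> below, this is inherited from the complex of words along the embedding \<open>letter_words\<close>.
\<close>

lemma keys_zero_boundary:
  assumes "Poly_Mapping.keys c \<subseteq> nonzero_tuples (Suc n)"
  shows "Poly_Mapping.keys (zero_boundary c) \<subseteq> nonzero_tuples n"
proof -
  note k = keys_letter_words[OF assms]
  have "Poly_Mapping.keys (word_boundary (letter_words c)) \<subseteq> {ws \<in> word_tuples n. good ws}"
    using keys_word_boundary[of "letter_words c" n] keys_word_boundary_good[OF k] k by blast
  then obtain z where "Poly_Mapping.keys z \<subseteq> nonzero_tuples n" "word_boundary (letter_words c) = letter_words z"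
    by (rule good_chain_letter_words)
  then show ?thesis by (simp add: letter_words_boundary[OF assms] letter_words_inject)
qed

lemma zero_boundary_zero_boundary:
  assumes "Poly_Mapping.keys c \<subseteq> nonzero_tuples (Suc n)"
  shows "zero_boundary (zero_boundary c) = 0"
proof -
  have "letter_words (zero_boundary (zero_boundary c)) = word_boundary (word_boundary (letter_words c))"
    by (simp add: letter_words_boundary[OF assms] letter_words_boundary[OF keys_zero_boundary[OF assms]])
  also have "\<dots> = letter_words 0"
    using word_boundary_word_boundary[of "letter_words c" "Suc n"] keys_letter_words[OF assms]
    by (auto simp: letter_words_simps)
  finally show ?thesis by (simp only: letter_words_inject)
qed

lemma word_classes_left_inverse:
  assumes "Poly_Mapping.keys c \<subseteq> word_tuples n"
  shows "push (map the_elem) (word_classes c) = c"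
  unfolding word_classes_def
proof (rule push_left_inverse)
  fix ws assume "ws \<in> Poly_Mapping.keys c"
  then have "set ws \<subseteq> zero_seqs" using assms by (auto simp: word_tuples_def)
  then show "map the_elem (map nu_class ws) = ws"
    by (induction ws) (auto simp: nu_class_eq)
qed

lemma word_classes_simps:
  "word_classes 0 = 0" "word_classes (c + d) = word_classes c + word_classes d"
  "word_classes (c - d) = word_classes c - word_classes d"
  by (simp_all add: word_classes_def push_add push_diff)

lemma keys_word_classes:
  assumes "Poly_Mapping.keys c \<subseteq> word_tuples n"
  shows "Poly_Mapping.keys (word_classes c) \<subseteq> reflector_tuples n"
proof -
  have "map nu_class ` word_tuples n \<subseteq> reflector_tuples n"
    by (auto simp: word_tuples_def reflector_tuples_def intro!: nu_class_in_reflector)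
  then show ?thesis using assms keys_push[of "map nu_class" c] unfolding word_classes_def by blast
qed

lemma reflector_chain_word_classes:
  assumes "Poly_Mapping.keys c \<subseteq> reflector_tuples n"
  obtains z where "Poly_Mapping.keys z \<subseteq> word_tuples n" "c = word_classes z"
proof
  have e: "the_elem X \<in> zero_seqs \<and> nu_class (the_elem X) = X" if "X \<in> reflector" for X :: "'s list set"
    using that by (auto elim!: reflectorE simp: nu_class_eq)
  have "map the_elem ` reflector_tuples n \<subseteq> (word_tuples n :: 's list list set)"
    by (auto simp: word_tuples_def reflector_tuples_def intro!: e[THEN conjunct1])
  then show "Poly_Mapping.keys (push (map the_elem) c) \<subseteq> word_tuples n"
    using assms keys_push[of "map the_elem" c] by blast
  show "c = word_classes (push (map the_elem) c)"
    unfolding word_classes_def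
  proof (rule push_left_inverse[symmetric])
    fix Xs assume "Xs \<in> Poly_Mapping.keys c"
    then have "set Xs \<subseteq> reflector" using assms by (auto simp: reflector_tuples_def)
    then show "map nu_class (map the_elem Xs) = Xs"
      by (induction Xs) (auto simp: e)
  qed
qed

text \<open>
  On the classes \<open>{w}\<close> this is the action of the 0-reflector. Elsewhere it is still additive in \<open>a\<close>.
\<close>

definition class_act :: "'a \<Rightarrow> 's list set \<Rightarrow> 'a" where
  "class_act a X = word_act a (the_elem X)"

lemma additive_class_act: "additive_action class_act"
  using additive_word_act by (simp add: additive_action_def class_act_def)

lemma reflector_boundary_class_act:
  assumes "Poly_Mapping.keys c \<subseteq> reflector_tuples n"
  shows "reflector_boundary c = bar_boundary reflector_mult class_act c"
proof (rule bar_boundary_cong)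
  fix X Xs a assume "X # Xs \<in> Poly_Mapping.keys c"
  then have "X \<in> reflector" using assms by (auto simp: reflector_tuples_def)
  then obtain w where w: "w \<in> zero_seqs" "X = nu_class w" by (rule reflectorE)
  then have "0 \<notin> set w" by (simp add: zero_seqs_def)
  with w show "reflector_act act a X = class_act a X"
    by (simp add: reflector_act_class[OF zero_module_axioms] class_act_def word_act_eq)
      (simp add: nu_class_eq word_act_eq)
qed

lemma word_classes_boundary:
  assumes "Poly_Mapping.keys c \<subseteq> word_tuples n"
  shows "reflector_boundary (word_classes c) = word_classes (word_boundary c)"
  unfolding reflector_boundary_class_act[OF keys_word_classes[OF assms]]
  unfolding word_classes_def
proof (rule bar_boundary_push[OF additive_word_act additive_class_act assms])
  fix ws :: "'s list list" assume "ws \<in> word_tuples n"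
  then have "set ws \<subseteq> zero_seqs" by (simp add: word_tuples_def)
  then show "successively (\<lambda>v w. nu_class (seq_mult v w) = reflector_mult (nu_class v) (nu_class w)) ws"
    by (induction ws rule: induct_list012) (auto simp: reflector_mult_class)
next
  show "class_act a (nu_class w) = word_act a w" if "w # ws \<in> word_tuples n" for a w ws
    using that by (simp add: class_act_def nu_class_eq word_tuples_def)
qed

lemma reflector_boundary_diff:
  assumes "c \<in> bar_chains reflector_tuples n" "d \<in> bar_chains reflector_tuples n"
  shows "reflector_boundary (c - d) = reflector_boundary c - reflector_boundary d"
proof -
  have "Poly_Mapping.keys (c - d) \<subseteq> reflector_tuples n" using keys_diff[of c d] assms unfolding bar_chains_def by blast
  then show "reflector_boundary (c - d) = reflector_boundary c - reflector_boundary d"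
    using reflector_boundary_class_act assms by (simp add: bar_chains_def bar_boundary_diff[OF additive_class_act])
qed

lemma keys_reflector_boundary:
  assumes "Poly_Mapping.keys c \<subseteq> reflector_tuples (Suc n)"
  shows "Poly_Mapping.keys (reflector_boundary c) \<subseteq> reflector_tuples n"
    "reflector_boundary (reflector_boundary c) = 0"
proof -
  obtain z where z: "Poly_Mapping.keys z \<subseteq> word_tuples (Suc n)" "c = word_classes z"
    using assms by (rule reflector_chain_word_classes)
  note kz = keys_word_boundary[OF z(1)]
  show "Poly_Mapping.keys (reflector_boundary c) \<subseteq> reflector_tuples n"
    unfolding z(2) word_classes_boundary[OF z(1)] by (rule keys_word_classes[OF kz])
  show "reflector_boundary (reflector_boundary c) = 0"
    unfolding z(2) word_classes_boundary[OF z(1)] word_classes_boundary[OF kz]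
    by (simp add: word_boundary_word_boundary[OF z(1)] word_classes_simps)
qed

section \<open>The isomorphism\<close>

lemma eps_boundary:
  assumes "Poly_Mapping.keys c \<subseteq> nonzero_tuples n"
  shows "reflector_boundary (eps c) = eps (zero_boundary c)"
  using word_classes_boundary[of "letter_words c" n] keys_letter_words[OF assms]
  by (auto simp: eps_eq letter_words_boundary[OF assms])

lemma keys_eps:
  fixes c :: "'s list \<Rightarrow>\<^sub>0 'a"
  assumes "Poly_Mapping.keys c \<subseteq> nonzero_tuples n"
  shows "Poly_Mapping.keys (eps c) \<subseteq> reflector_tuples n"
  unfolding eps_eq using keys_letter_words[OF assms] by (intro keys_word_classes) blast

lemma eps_add: "eps (c + d) = eps c + eps (d :: 's list \<Rightarrow>\<^sub>0 'a)"
  by (simp add: eps_eq letter_words_simps word_classes_simps)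

lemma eps_zero: "eps (0 :: 's list \<Rightarrow>\<^sub>0 'a) = 0"
  by (simp add: eps_eq letter_words_simps word_classes_simps)

lemma word_classes_inject:
  assumes "Poly_Mapping.keys c \<subseteq> word_tuples n" "Poly_Mapping.keys d \<subseteq> word_tuples n"
    and "word_classes c = word_classes d"
  shows "c = d"
proof -
  have "c = push (map the_elem) (word_classes c)" by (rule word_classes_left_inverse[OF assms(1), symmetric])
  also have "\<dots> = d" unfolding assms(3) by (rule word_classes_left_inverse[OF assms(2)])
  finally show ?thesis .
qed

text \<open>
  If \<open>eps x\<close> is the boundary of \<open>v\<close>, then \<open>v\<close> has a good boundary and so can be changed by a boundary
  into a good chain, whose boundary in the 0-complex is \<open>x\<close>.
\<close>

lemma eps_reflects_boundaries:
  assumes x: "Poly_Mapping.keys x \<subseteq> nonzero_tuples n"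
    and y: "Poly_Mapping.keys y \<subseteq> reflector_tuples (Suc n)" "eps x = reflector_boundary y"
  shows "\<exists>z. Poly_Mapping.keys z \<subseteq> nonzero_tuples (Suc n) \<and> x = zero_boundary z"
proof -
  obtain v where v: "Poly_Mapping.keys v \<subseteq> word_tuples (Suc n)" "y = word_classes v"
    using y(1) by (rule reflector_chain_word_classes)
  note kx = keys_letter_words[OF x]
  have bv: "word_boundary v = letter_words x"
  proof (rule word_classes_inject)
    show "word_classes (word_boundary v) = word_classes (letter_words x)"
      using y(2) by (simp add: v(2) eps_eq word_classes_boundary[OF v(1)])
    show "Poly_Mapping.keys (letter_words x) \<subseteq> word_tuples n" using kx by blast
  qed (rule keys_word_boundary[OF v(1)])
  obtain d where d: "Poly_Mapping.keys d \<subseteq> word_tuples (Suc (Suc n))"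
    "Poly_Mapping.keys (v - word_boundary d) \<subseteq> {ws \<in> word_tuples (Suc n). good ws}"
    using relative_acyclicity[OF v(1)] kx unfolding bv by blast
  obtain z where z: "Poly_Mapping.keys z \<subseteq> nonzero_tuples (Suc n)" "v - word_boundary d = letter_words z"
    using d(2) by (rule good_chain_letter_words)
  have "letter_words (zero_boundary z) = word_boundary (v - word_boundary d)"
    unfolding z(2) by (rule letter_words_boundary[OF z(1), symmetric])
  also have "\<dots> = letter_words x"
    by (simp add: word_boundary_diff word_boundary_word_boundary[OF d(1)] bv)
  finally show ?thesis using z(1) letter_words_inject by metis
qed

text \<open>
  A cycle has the zero boundary, which is good, so it is homologous to a good chain.
\<close>

lemma eps_surjective_on_homology:
  assumes y: "Poly_Mapping.keys y \<subseteq> reflector_tuples n" "reflector_boundary y = 0"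
  shows "\<exists>x e. Poly_Mapping.keys x \<subseteq> nonzero_tuples n \<and> zero_boundary x = 0
     \<and> Poly_Mapping.keys e \<subseteq> reflector_tuples (Suc n) \<and> y - eps x = reflector_boundary e"
proof -
  obtain v where v: "Poly_Mapping.keys v \<subseteq> word_tuples n" "y = word_classes v"
    using y(1) by (rule reflector_chain_word_classes)
  have "push (map the_elem) (word_classes (word_boundary v)) = word_boundary v"
  proof (cases n)
    (* There is no degree below 0; the boundary of the empty tuple is zero. *)
    case 0
    have "inner_faces seq_mult ws a = 0" "first_face word_act ws a = 0"
      if "ws \<in> Poly_Mapping.keys v" for ws a
      using that v(1) 0 by (auto simp: word_tuples_def)
    then have "word_boundary v = 0" by (simp add: bar_boundary_eq_lin_ext lin_ext_def)
    then show ?thesis by (simp add: word_classes_simps)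
  next
    case (Suc m)
    then show ?thesis using v(1) keys_word_boundary word_classes_left_inverse by blast
  qed
  moreover have "word_classes (word_boundary v) = 0"
    using y(2) by (simp add: v(2) word_classes_boundary[OF v(1)])
  ultimately have bv: "word_boundary v = 0" by simp
  obtain d where d: "Poly_Mapping.keys d \<subseteq> word_tuples (Suc n)"
    "Poly_Mapping.keys (v - word_boundary d) \<subseteq> {ws \<in> word_tuples n. good ws}"
    using relative_acyclicity[OF v(1)] unfolding bv by auto
  obtain x where x: "Poly_Mapping.keys x \<subseteq> nonzero_tuples n" "v - word_boundary d = letter_words x"
    using d(2) by (rule good_chain_letter_words)
  have "letter_words (zero_boundary x) = word_boundary (v - word_boundary d)"
    unfolding x(2) by (rule letter_words_boundary[OF x(1), symmetric])
  also have "\<dots> = letter_words 0"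
    by (simp add: word_boundary_diff word_boundary_word_boundary[OF d(1)] bv letter_words_simps)
  finally have "zero_boundary x = 0" by (simp only: letter_words_inject)
  moreover have "y - eps x = reflector_boundary (word_classes d)"
    unfolding eps_eq x(2)[symmetric] v(2) word_classes_boundary[OF d(1)]
    by (simp add: word_classes_simps)
  ultimately show ?thesis using x(1) keys_word_classes[OF d(1)] by blast
qed

lemma eps_star_iso: "eps_star act n \<in> iso (zero_homology act n) (reflector_homology act n)"
proof -
  let ?Z = "{c \<in> bar_chains nonzero_tuples n. zero_boundary c = 0}"
  let ?B = "bar_boundaries nonzero_tuples (*) act n"
  let ?Z' = "{c \<in> bar_chains reflector_tuples n. reflector_boundary c = 0}"
  let ?B' = "bar_boundaries reflector_tuples reflector_mult (reflector_act act) n"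
  note Z = add_subgroup_kernel_image[OF add_subgroup_bar_chains zero_boundary_diff]
  note Z' = add_subgroup_kernel_image[OF add_subgroup_bar_chains reflector_boundary_diff]
  have "?B \<subseteq> ?Z"
    using keys_zero_boundary[of _ n] zero_boundary_zero_boundary[of _ n]
    unfolding bar_boundaries_def bar_chains_def by blast
  moreover have "?B' \<subseteq> ?Z'"
    using keys_reflector_boundary[of _ n] unfolding bar_boundaries_def bar_chains_def by blast
  moreover have "eps ` ?Z \<subseteq> ?Z'"
    using keys_eps[of _ n] by (auto simp: bar_chains_def eps_boundary eps_zero)
  moreover have "eps x \<in> ?B' \<longleftrightarrow> x \<in> ?B" if "x \<in> ?Z" for x
  proof
    assume "eps x \<in> ?B'"
    then show "x \<in> ?B"
      using that eps_reflects_boundaries[of x n] by (auto simp: bar_boundaries_def bar_chains_def)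
  next
    assume "x \<in> ?B"
    then obtain z where z: "Poly_Mapping.keys z \<subseteq> nonzero_tuples (Suc n)" "x = zero_boundary z"
      by (auto simp: bar_boundaries_def bar_chains_def)
    then show "eps x \<in> ?B'"
      using eps_boundary[OF z(1)] keys_eps[OF z(1)] by (auto simp: bar_boundaries_def bar_chains_def image_iff)
  qed
  moreover have "\<exists>x\<in>?Z. y - eps x \<in> ?B'" if y: "y \<in> ?Z'" for y
  proof -
    obtain x e where "Poly_Mapping.keys x \<subseteq> nonzero_tuples n" "zero_boundary x = 0"
      "Poly_Mapping.keys e \<subseteq> reflector_tuples (Suc n)" "y - eps x = reflector_boundary e"
      using eps_surjective_on_homology[of y n] y unfolding bar_chains_def by blast
    then show ?thesis by (intro bexI[of _ x]) (auto simp: bar_boundaries_def bar_chains_def)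
  qed
  ultimately have "(\<lambda>X. \<Union>x\<in>X. ?B' #>\<^bsub>add_monoid ?Z'\<^esub> eps x)
      \<in> iso (add_monoid ?Z Mod ?B) (add_monoid ?Z' Mod ?B')"
    unfolding bar_boundaries_def by (intro quotient_map_iso Z Z' eps_add)
  moreover have "eps_star act n = (\<lambda>X. \<Union>x\<in>X. ?B' #>\<^bsub>add_monoid ?Z'\<^esub> eps x)"
    by (rule ext) (simp add: eps_star_def bar_cycle_group_def add_monoid_def)
  ultimately show ?thesis
    by (simp add: bar_homology_def bar_cycle_group_def add_monoid_def)
qed

end

theorem theorem2p2:
  fixes act :: "'a::ab_group_add \<Rightarrow> 's::{semigroup_mult,mult_zero} \<Rightarrow> 'a"
    and n :: nat
  assumes "\<forall>x y z :: 's. x * y * z = 0 \<longrightarrow> x * y = 0 \<or> y * z = 0"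
    and "zero_module act"
  shows "eps_star act n \<in> iso (zero_homology act n) (reflector_homology act n)"
proof -
  interpret zero_module act by fact
  interpret categorical_zero_module act by unfold_locales (use assms(1) in blast)
  show ?thesis by (rule eps_star_iso)
qed

end
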